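(* Let $p$ be a prime, $q=p^l$, $n\ge 2$ and $k\ge1$ integers, $d=\gcd(k,q-1)$, and let $\ell$ be the divisor of $l$ such that the set of all finite sums of $k$-th powers of elements of $\mathbb F_q$ equals $\mathbb F_{p^\ell}$. Assume $\ell=l$ and $p\nmid k$. Then every matrix in $M_n(\mathbb F_q)$ is of the form $A^k+B^k$ with $A,B\in M_n(\mathbb F_q)$ in each of the following cases: (i) $q\ge 3d+1$ and either ($d>2$ and $n>\max\{\frac{d-1}{2},\frac{4\ln(k-1)}{\ln q}\}$) or $d=2$; (ii) $q=2d+1$ and either ($d>2$ and $n>\max\{2d-1,\frac{4\ln(k-1)}{\ln q}\}$) or $d=2$.
   Context: Convention: $\ln(0)=-\infty$. *)

theory Defs
  imports
    "HOL-Computational_Algebra.Primes"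
    "HOL-Library.Cardinality"
    "HOL-Library.Extended_Real"
    "HOL-Algebra.Subrings"
    "HOL-Algebra.Algebraic_Closure_Type"
    "Jordan_Normal_Form.Matrix"
begin

definition power_sums :: "nat \<Rightarrow> 'a::comm_semiring_1 set" where
  "power_sums k = {(\<Sum>x\<leftarrow>xs. x ^ k) | xs. True}"

(* In a finite field a subfield is determined by its cardinality, so for a set K this
   says that K is the subfield with m elements of the field carried by the type. *)
definition is_subfield_of_order :: "'a::field set \<Rightarrow> nat \<Rightarrow> bool" where
  "is_subfield_of_order K m \<longleftrightarrow> subfield K (ring_of_type_algebra :: 'a ring) \<and> card K = m"

(* The library sets ln 0 = 0 on the reals; here ln 0 is minus infinity.
   Only used for nonnegative arguments. *)
definition eln :: "real \<Rightarrow> ereal" where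
  "eln x = (if x = 0 then - \<infinity> else ereal (ln x))"

end

theory Submission
  imports Defs "Jordan_Normal_Form.Determinant" "Jordan_Normal_Form.Column_Operations"
begin

text \<open>
  A triangular matrix whose diagonal consists of \<open>k\<close>-th powers, with \<open>0\<close> occurring at most once, is a
  \<open>k\<close>-th power when \<open>k\<close> is invertible.  By Fillmore's theorem a nonscalar matrix \<open>M\<close> is similar to one
  with any prescribed diagonal of the right trace.  Splitting that matrix into a lower and an upper triangular
  part, \<open>M\<close> is a sum of two \<open>k\<close>-th powers as soon as its trace is a sum of \<open>2 n\<close> elements that are nonzero
  \<open>k\<close>-th powers, up to one zero in each part.  The latter is additive combinatorics in \<open>F\<^sub>q\<close>: sumsets of the
  group \<open>S\<close> of nonzero \<open>k\<close>-th powers grow by a full coset of \<open>S\<close> in each step; only trace \<open>0\<close> with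
  \<open>2 n = (q - 1) / |S|\<close> needs an extra argument.  A scalar matrix is the image of a scalar under the
  regular representation of the field with \<open>q^n\<close> elements, in which every element is a sum of two
  \<open>k\<close>-th powers because \<open>q^n > (k - 1)^4\<close>; for \<open>d = 2\<close> the pigeonhole principle in \<open>F\<^sub>q\<close> suffices.
\<close>

section \<open>Sums of two powers in a large finite field\<close>

text \<open>The condition \<open>ell = l\<close> enters as: S generates the additive group of the
  field. A nonempty set invariant under multiplication by S and under one nonzero translation is
  then everything, which is what forces sumsets to grow. The bound n > (d - 1) / 2 gives only d <= 2
  n. As growth is by one coset per summand, 2 n summands are just enough to reach every nonzero
  element, and when the index of S is exactly 2 n nothing is left over to reach 0. It helps that
  each triangular part tolerates one zero, which makes 2 n - 1 and 2 n - 2 summands admissible too.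
  Coset growth needs |S| >= 3: for S = {1, -1} in a prime field the size grows by only one per step.
  Case (ii) guarantees only |S| >= 2, hence its separate linear bound on n. The fourth power in q^n
  > (k - 1)^4 comes from e^4 - 1 = (e + 1) (e^3 - e^2 + e - 1): it turns a bound on the field size
  (e + 1) m + 1 into the bound m >= e^3 - e^2 + e that the second moment needs.\<close>

lemma card_roots_unity_le:
  fixes k :: nat
  assumes "k > 0"
  shows "finite {x :: 'a :: idom. x ^ k = 1}" "card {x :: 'a :: idom. x ^ k = 1} \<le> k"
proof -
  let ?P = "monom 1 k - 1 :: 'a poly"
  have deg: "degree ?P \<le> k"
    by (intro degree_diff_le) (auto simp: degree_monom_le)
  have "coeff ?P k = 1" using assms by simp
  then have nz: "?P \<noteq> 0" by (metis coeff_0 zero_neq_one)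
  have eq: "{x :: 'a. x ^ k = 1} = {x. poly ?P x = 0}"
    by (auto simp: poly_monom)
  show "finite {x :: 'a :: idom. x ^ k = 1}" unfolding eq by (rule poly_roots_finite[OF nz])
  show "card {x :: 'a :: idom. x ^ k = 1} \<le> k"
    unfolding eq using card_poly_roots_bound[OF nz] deg by linarith
qed

text \<open>The fibres of x^k on the group U are cosets of its kernel. U is a set closed under
  products and quotients, so that the lemma fits both a finite subfield of a larger field and the
  nonzero elements of a whole type.\<close>

lemma card_eq_card_kernel_mult_card_powers:
  fixes U :: "'a :: field set"
  assumes fin: "finite U" and nz: "0 \<notin> U"
    and mult: "\<And>x y. x \<in> U \<Longrightarrow> y \<in> U \<Longrightarrow> x * y \<in> U"
    and divide: "\<And>x y. x \<in> U \<Longrightarrow> y \<in> U \<Longrightarrow> x / y \<in> U"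
  shows "card U = card {x \<in> U. x ^ k = 1} * card ((\<lambda>x. x ^ k) ` U)"
proof -
  have fibre: "card {x \<in> U. x ^ k = y} = card {x \<in> U. x ^ k = 1}" if "y \<in> (\<lambda>x. x ^ k) ` U" for y
  proof -
    obtain u where u: "u \<in> U" "y = u ^ k" using \<open>y \<in> _\<close> by blast
    have u0: "u \<noteq> 0" using u nz by auto
    have "bij_betw (\<lambda>x. x * u) {x \<in> U. x ^ k = 1} {x \<in> U. x ^ k = y}"
      by (rule bij_betwI[where g = "\<lambda>x. x / u"])
         (use u u0 mult divide in \<open>auto simp: power_mult_distrib power_divide\<close>)
    then show ?thesis by (simp add: bij_betw_same_card)
  qed
  have "card U = (\<Sum>y\<in>(\<lambda>x. x ^ k) ` U. \<Sum>x | x \<in> U \<and> x ^ k = y. 1)"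
    using sum.image_gen[OF fin, of "\<lambda>_. 1::nat" "\<lambda>x. x ^ k"] by simp
  also have "\<dots> = (\<Sum>y\<in>(\<lambda>x. x ^ k) ` U. card {x \<in> U. x ^ k = 1})"
    by (intro sum.cong) (auto simp: fibre)
  finally show ?thesis by simp
qed

text \<open>Expand (f - \<mu>)^2 >= 0 and sum. For \<mu> the mean of f this is Cauchy-Schwarz; a
  free \<mu> avoids dividing by the sizes.\<close>

lemma sum_sq_lower_bound:
  fixes f :: "'a \<Rightarrow> 'b \<Rightarrow> real" and \<mu> :: real
  assumes "finite A" "finite B"
  shows "(\<Sum>x\<in>A. \<Sum>y\<in>B. (f x y)\<^sup>2) \<ge> 2 * \<mu> * (\<Sum>x\<in>A. \<Sum>y\<in>B. f x y) - \<mu>\<^sup>2 * card A * card B"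
proof -
  have "(\<Sum>x\<in>A. \<Sum>y\<in>B. 2 * \<mu> * f x y - \<mu>\<^sup>2) \<le> (\<Sum>x\<in>A. \<Sum>y\<in>B. (f x y)\<^sup>2)"
  proof (intro sum_mono)
    fix x y
    have "0 \<le> (f x y - \<mu>)\<^sup>2" by simp
    then show "2 * \<mu> * f x y - \<mu>\<^sup>2 \<le> (f x y)\<^sup>2" by (simp add: power2_diff algebra_simps)
  qed
  then show ?thesis by (simp add: sum_subtractf sum_distrib_left algebra_simps)
qed

text \<open>The left summands are lower bounds for the second moment on three blocks, the right side
  is its upper bound, all divided by m^2. Multiplying by e^2 leaves m (m - (e^3 - e^2 + e)) + 2 m +
  1 - e^2 <= 0. This is impossible, since e^3 - e^2 + e = e (e - 1)^2 + e^2 also gives m >=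
  e^2.\<close>

lemma variance_inequality_contradiction:
  fixes m e :: real
  assumes e: "e \<ge> 1" and m: "m \<ge> e ^ 3 - e ^ 2 + e"
    and le: "m * (m + 1) / e + m\<^sup>2 / e + ((e - 1) * m - 1)\<^sup>2 / e\<^sup>2 \<le> (e + 1) * m + (m - 1)\<^sup>2"
  shows False
proof -
  have "e\<^sup>2 * (m * (m + 1) / e + m\<^sup>2 / e + ((e - 1) * m - 1)\<^sup>2 / e\<^sup>2) \<le> e\<^sup>2 * ((e + 1) * m + (m - 1)\<^sup>2)"
    using le by (intro mult_left_mono) auto
  also have "e\<^sup>2 * (m * (m + 1) / e + m\<^sup>2 / e + ((e - 1) * m - 1)\<^sup>2 / e\<^sup>2)
      = e * (m * (m + 1)) + e * m\<^sup>2 + ((e - 1) * m - 1)\<^sup>2"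
    using e by (simp add: field_simps power2_eq_square)
  finally have 1: "m * (m - (e ^ 3 - e ^ 2 + e)) + 2 * m + 1 - e\<^sup>2 \<le> 0"
    by (simp add: algebra_simps power2_eq_square power3_eq_cube)
  have e2: "e * (e - 1) ^ 2 \<ge> 0" using e by simp
  have "m \<ge> e * (e - 1) ^ 2 + e\<^sup>2"
    using m by (simp add: algebra_simps power2_eq_square power3_eq_cube)
  then have m2: "m \<ge> e\<^sup>2" using e2 by linarith
  moreover have "e\<^sup>2 \<ge> 0" by simp
  ultimately have "m \<ge> 0" by linarith
  then have "m * (m - (e ^ 3 - e ^ 2 + e)) \<ge> 0" using m by simp
  with 1 m2 \<open>m \<ge> 0\<close> show False by linarith
qed

lemma sum_rotate:
  "(\<Sum>x\<in>A. \<Sum>y\<in>B. \<Sum>z\<in>C. f x y z) = (\<Sum>y\<in>B. \<Sum>z\<in>C. \<Sum>x\<in>A. f x y z)"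
proof -
  have "(\<Sum>x\<in>A. \<Sum>y\<in>B. \<Sum>z\<in>C. f x y z) = (\<Sum>y\<in>B. \<Sum>x\<in>A. \<Sum>z\<in>C. f x y z)" by (rule sum.swap)
  also have "\<dots> = (\<Sum>y\<in>B. \<Sum>z\<in>C. \<Sum>x\<in>A. f x y z)" by (intro sum.cong refl sum.swap)
  finally show ?thesis .
qed

text \<open>A second moment argument.  Let \<open>G\<close> be the group of nonzero \<open>k\<close>-th powers, of index \<open>e + 1\<close> and
  order \<open>m\<close>, and let \<open>R c x\<close> count the \<open>g \<in> G\<close> with \<open>x + c g \<in> lam G\<close>.  If \<open>lam\<close> is not a sum of two
  \<open>k\<close>-th powers, then \<open>R c x = 0\<close> for \<open>c \<in> G\<close>, \<open>x \<in> G \<union> {0}\<close>.  This makes \<open>R\<close> so unevenly distributed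
  that its second moment, which can be computed exactly, is too small unless \<open>m < e^3 - e^2 + e\<close>.\<close>
lemma sum_of_two_powers:
  fixes K :: "'a :: field set" and k :: nat
  assumes fin: "finite K" and zero: "0 \<in> K" and one: "1 \<in> K"
    and diff: "\<And>x y. x \<in> K \<Longrightarrow> y \<in> K \<Longrightarrow> x - y \<in> K"
    and mult: "\<And>x y. x \<in> K \<Longrightarrow> y \<in> K \<Longrightarrow> x * y \<in> K"
    and divide: "\<And>x y. x \<in> K \<Longrightarrow> y \<in> K \<Longrightarrow> x / y \<in> K"
    and k: "k \<ge> 1" and large: "card K > (k - 1) ^ 4" and lam: "lam \<in> K"
  shows "\<exists>a\<in>K. \<exists>b\<in>K. lam = a ^ k + b ^ k"
proof (rule ccontr)
  assume no: "\<not> ?thesis"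
  define Ks where "Ks = K - {0}"
  define G where "G = (\<lambda>x. x ^ k) ` Ks"
  define G0 where "G0 = insert 0 G"
  define H where "H = (*) lam ` G"
  have zk: "(0::'a) ^ k = 0" using k by simp
  have lam0: "lam \<noteq> 0" using no zero zk by (metis add_0)
  have powK: "x ^ j \<in> K" if "x \<in> K" for x and j :: nat
    using that by (induction j) (auto simp: one mult)
  have finKs: "finite Ks" and finG: "finite G" using fin by (auto simp: Ks_def G_def)
  have GK: "G \<subseteq> Ks" using powK by (auto simp: G_def Ks_def)
  have HK: "H \<subseteq> Ks" using GK lam lam0 mult by (fastforce simp: H_def Ks_def)
  have G0K: "G0 \<subseteq> K" using GK zero by (auto simp: G0_def Ks_def)
  have G0pow: "\<exists>a\<in>K. x = a ^ k" if "x \<in> G0" for x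
    using that zero zk unfolding G0_def G_def Ks_def by (auto intro: bexI[of _ 0])
  have Gmult: "x * y \<in> G" if "x \<in> G" "y \<in> G" for x y
    using that mult unfolding G_def Ks_def by (auto simp flip: power_mult_distrib)
  have Gdiv: "x / y \<in> G" if "x \<in> G" "y \<in> G" for x y
    using that divide unfolding G_def Ks_def by (auto simp flip: power_divide)
  have G0div: "x / y \<in> G0" if "x \<in> G0" "y \<in> G" for x y
    using that Gdiv unfolding G0_def by auto
  have nolam: "lam \<noteq> x + y" if "x \<in> G0" "y \<in> G0" for x y
    using no G0pow that by blast
  define M where "M = card G"
  define D where "D = card {x \<in> Ks. x ^ k = 1}"
  have cKs: "card Ks = D * M" unfolding D_def M_def G_def
    by (rule card_eq_card_kernel_mult_card_powers) (use fin mult divide in \<open>auto simp: Ks_def\<close>)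
  have cH: "card H = M" unfolding H_def M_def using lam0 by (intro card_image) (auto simp: inj_on_def)
  have finH: "finite H" using finG by (simp add: H_def)
  have Dk: "D \<le> k"
  proof -
    have "D \<le> card {x::'a. x ^ k = 1}" unfolding D_def
      using card_roots_unity_le(1)[of k, where 'a='a] k by (intro card_mono) auto
    then show ?thesis using card_roots_unity_le(2)[of k, where 'a='a] k by simp
  qed
  have D1: "D \<ge> 1"
  proof -
    have "1 \<in> {x \<in> Ks. x ^ k = 1}" using one by (simp add: Ks_def)
    then show ?thesis unfolding D_def using finKs by (auto simp: Suc_le_eq card_gt_0_iff)
  qed
  have M1: "M \<ge> 1"
  proof -
    have "1 \<in> G" using one by (auto simp: G_def Ks_def intro!: image_eqI[of _ _ 1])
    then show ?thesis unfolding M_def using finG by (auto simp: Suc_le_eq card_gt_0_iff)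
  qed
  have cK: "card K = card Ks + 1" unfolding Ks_def using fin zero by (simp add: card_Diff_singleton card_gt_0_iff) (metis Suc_pred card_gt_0_iff empty_iff)
  have D2: "D \<ge> 2"
  proof (rule ccontr)
    assume "\<not> 2 \<le> D"
    then have "D = 1" using D1 by simp
    then have "card G = card Ks" using cKs M_def by simp
    then have "G = Ks" using GK finKs by (simp add: card_subset_eq)
    then have "lam \<in> G0" using lam lam0 by (simp add: G0_def Ks_def)
    then show False using nolam[of lam 0] by (simp add: G0_def)
  qed
  define e where "e = real D - 1"
  define m where "m = real M"
  have e1: "e \<ge> 1" using D2 by (simp add: e_def)
  have mpos: "m \<ge> 1" using M1 by (simp add: m_def)
  have rKs: "real (card Ks) = (e + 1) * m" using cKs by (simp add: e_def m_def)
  \<comment> \<open>The size hypothesis and D <= k give e^4 <= (e + 1) m, which yields only m > e^3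
    - e^2 + e - 1. Both sides are integers, so the detour through \<open>int\<close> gains the
    missing 1.\<close>
  have mbig: "m \<ge> e ^ 3 - e ^ 2 + e"
  proof -
    have "(D - 1) ^ 4 \<le> (k - 1) ^ 4" using Dk by (intro power_mono) auto
    then have "(D - 1) ^ 4 \<le> D * M" using large unfolding cK cKs by linarith
    then have "real ((D - 1) ^ 4) \<le> real (D * M)" by (rule of_nat_mono)
    then have "e ^ 4 \<le> (e + 1) * m" using D1 by (simp add: e_def m_def of_nat_diff)
    moreover have "e ^ 4 - 1 = (e + 1) * (e ^ 3 - e ^ 2 + e - 1)"
      by (simp add: algebra_simps power2_eq_square power3_eq_cube power4_eq_xxxx)
    ultimately have "(e + 1) * (e ^ 3 - e ^ 2 + e - 1) < (e + 1) * m" by linarith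
    then have "e ^ 3 - e ^ 2 + e - 1 < m" using e1 by (simp add: mult_less_cancel_left_pos)
    moreover have "e ^ 3 - e ^ 2 + e - 1 = of_int ((int D - 1) ^ 3 - (int D - 1) ^ 2 + (int D - 1) - 1)"
      by (simp add: e_def)
    moreover have "m = of_int (int M)" by (simp add: m_def)
    ultimately have "(int D - 1) ^ 3 - (int D - 1) ^ 2 + (int D - 1) - 1 < int M" by (metis of_int_less_iff)
    then have "(int D - 1) ^ 3 - (int D - 1) ^ 2 + (int D - 1) \<le> int M" by simp
    then have "real_of_int ((int D - 1) ^ 3 - (int D - 1) ^ 2 + (int D - 1)) \<le> real_of_int (int M)" by (simp only: of_int_le_iff)
    then show ?thesis by (simp add: e_def m_def)
  qed
  define R where "R = (\<lambda>c x. \<Sum>g\<in>G. \<Sum>h\<in>H. of_bool (x = h - c * g) :: real)"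
  have S1: "(\<Sum>x\<in>K. R c x) = m\<^sup>2" if "c \<in> Ks" for c
  proof -
    have "(\<Sum>x\<in>K. R c x) = (\<Sum>g\<in>G. \<Sum>h\<in>H. \<Sum>x\<in>K. of_bool (x = h - c * g))"
      unfolding R_def by (rule sum_rotate)
    also have "\<dots> = (\<Sum>g\<in>G. \<Sum>h\<in>H. 1)"
    proof (intro sum.cong refl)
      fix g h assume "g \<in> G" "h \<in> H"
      then have "h - c * g \<in> K" using that GK HK diff mult unfolding Ks_def by blast
      then show "(\<Sum>x\<in>K. of_bool (x = h - c * g)) = (1::real)"
        using fin by (simp add: of_bool_def)
    qed
    finally show ?thesis by (simp add: cH m_def M_def power2_eq_square)
  qed
  \<comment> \<open>Each pair (g, h) determines c = (h - x) / g. It is nonzero: if h = lam g' were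
    x, then lam = x / g' would lie in \<open>G0\<close>, against \<open>nolam\<close>.\<close>
  have S3: "(\<Sum>c\<in>Ks. R c x) = m\<^sup>2" if x: "x \<in> G0" for x
  proof -
    have "(\<Sum>c\<in>Ks. R c x) = (\<Sum>g\<in>G. \<Sum>h\<in>H. \<Sum>c\<in>Ks. of_bool (x = h - c * g))"
      unfolding R_def by (rule sum_rotate)
    also have "\<dots> = (\<Sum>g\<in>G. \<Sum>h\<in>H. 1)"
    proof (intro sum.cong refl)
      fix g h assume gh: "g \<in> G" "h \<in> H"
      then obtain g' where g': "g' \<in> G" "h = lam * g'" by (auto simp: H_def)
      have nz: "g \<noteq> 0" "g' \<noteq> 0" using gh g' GK by (auto simp: Ks_def)
      have "h \<noteq> x"
      proof
        assume "h = x"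
        then have "lam = x / g' + 0" using g' nz by (simp add: eq_divide_eq)
        then show False using nolam[OF G0div[OF x g'(1)], of 0] by (simp add: G0_def)
      qed
      moreover have "h - x \<in> K" using gh HK G0K x diff unfolding Ks_def by blast
      then have "(h - x) / g \<in> K" using gh GK divide unfolding Ks_def by blast
      ultimately have in_K: "(h - x) / g \<in> Ks" using nz by (simp add: Ks_def)
      have "(x = h - c * g) = (c = (h - x) / g)" for c using nz by (auto simp: field_simps)
      then show "(\<Sum>c\<in>Ks. of_bool (x = h - c * g)) = (1::real)"
        using finKs in_K by (simp add: of_bool_def)
    qed
    finally show ?thesis by (simp add: cH m_def M_def power2_eq_square)
  qed
  \<comment> \<open>Squaring counts pairs (g, h), (g', h') with h - c g = h' - c g', that is c (g -
    g') = h - h'. Equal pairs allow all (e + 1) m values of c, pairs differing in both components at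
    most one, all others none.\<close>
  have S2: "(\<Sum>c\<in>Ks. \<Sum>x\<in>K. (R c x)\<^sup>2) \<le> m\<^sup>2 * ((e + 1) * m) + m\<^sup>2 * (m - 1)\<^sup>2"
  proof -
    have "(\<Sum>c\<in>Ks. \<Sum>x\<in>K. (R c x)\<^sup>2) =
      (\<Sum>c\<in>Ks. \<Sum>x\<in>K. \<Sum>(g,h)\<in>G\<times>H. \<Sum>(g',h')\<in>G\<times>H. of_bool (x = h - c * g) * of_bool (x = h' - c * g'))"
      unfolding R_def power2_eq_square
      by (simp add: sum.cartesian_product sum_product split_def)
    also have "\<dots> = (\<Sum>(g,h)\<in>G\<times>H. \<Sum>(g',h')\<in>G\<times>H. \<Sum>c\<in>Ks. \<Sum>x\<in>K. of_bool (x = h - c * g) * of_bool (x = h' - c * g'))"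
      unfolding split_def
      by (subst sum_rotate[where A = K]) (rule sum_rotate)
    also have "\<dots> \<le> (\<Sum>(g,h)\<in>G\<times>H. \<Sum>(g',h')\<in>G\<times>H. 
        of_bool (g = g' \<and> h = h') * ((e + 1) * m) + of_bool (g' \<noteq> g) * of_bool (h' \<noteq> h))"
      unfolding split_def
    proof (intro sum_mono)
      fix u v assume uv: "u \<in> G \<times> H" "v \<in> G \<times> H"
      obtain g h where u: "u = (g, h)" by (cases u)
      obtain g' h' where v: "v = (g', h')" by (cases v)
      have "(\<Sum>x\<in>K. of_bool (x = h - c * g) * of_bool (x = h' - c * g')) = (of_bool (c * (g - g') = h - h') :: real)"
        if "c \<in> Ks" for c
      proof -
        have "h - c * g \<in> K" using that uv u GK HK diff mult unfolding Ks_def by blast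
        then have "(\<Sum>x\<in>K. of_bool (x = h - c * g) * of_bool (x = h' - c * g')) = (of_bool (h - c * g = h' - c * g') :: real)"
          using fin by (simp add: of_bool_def if_distrib[of "\<lambda>x. x * _"] cong: if_cong)
        also have "(h - c * g = h' - c * g') = (c * (g - g') = h - h')" by (auto simp: algebra_simps)
        finally show ?thesis .
      qed
      then have "(\<Sum>c\<in>Ks. \<Sum>x\<in>K. of_bool (x = h - c * g) * of_bool (x = h' - c * g')) =
         (\<Sum>c\<in>Ks. of_bool (c * (g - g') = h - h') :: real)" by simp
      also have "\<dots> \<le> of_bool (g = g' \<and> h = h') * ((e + 1) * m) + of_bool (g' \<noteq> g) * of_bool (h' \<noteq> h)"
      proof (cases "g = g'")
        case True
        then show ?thesis by (auto simp: rKs)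
      next
        case False
        then have gg: "g - g' \<noteq> 0" by simp
        show ?thesis
        proof (cases "h = h'")
          case True
          have "(\<Sum>c\<in>Ks. of_bool (c * (g - g') = h - h')) = (\<Sum>c\<in>Ks. 0::real)"
            using True gg by (intro sum.cong) (auto simp: Ks_def)
          then show ?thesis using False by simp
        next
          case hh: False
          have "(c * (g - g') = h - h') = (c = (h - h') / (g - g'))" for c using gg by (auto simp: field_simps)
          then have "(\<Sum>c\<in>Ks. of_bool (c * (g - g') = h - h')) \<le> (1::real)"
            using finKs by (simp add: of_bool_def)
          then show ?thesis using False hh by simp
        qed
      qed
      finally show "(\<Sum>c\<in>Ks. \<Sum>x\<in>K. of_bool (x = snd u - c * fst u) * of_bool (x = snd v - c * fst v)) \<le>
          of_bool (fst u = fst v \<and> snd u = snd v) * ((e + 1) * m) + of_bool (fst v \<noteq> fst u) * of_bool (snd v \<noteq> snd u)"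
        by (simp add: u v)
    qed
    also have "\<dots> = (\<Sum>(g,h)\<in>G\<times>H. (e + 1) * m + (m - 1)\<^sup>2)"
    proof (intro sum.cong refl)
      fix u assume u: "u \<in> G \<times> H"
      obtain g h where gh: "u = (g, h)" by (cases u)
      have a: "(\<Sum>g'\<in>G. of_bool (g' \<noteq> g) :: real) = m - 1"
      proof -
        have "(\<Sum>g'\<in>G. of_bool (g' \<noteq> g) :: real) = (\<Sum>g'\<in>G. 1 - of_bool (g' = g))"
          by (intro sum.cong) auto
        then show ?thesis using u gh finG by (simp add: sum_subtractf of_bool_def m_def M_def)
      qed
      have b: "(\<Sum>h'\<in>H. of_bool (h' \<noteq> h) :: real) = m - 1"
      proof -
        have "(\<Sum>h'\<in>H. of_bool (h' \<noteq> h) :: real) = (\<Sum>h'\<in>H. 1 - of_bool (h' = h))"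
          by (intro sum.cong) auto
        then show ?thesis using u gh finH by (simp add: sum_subtractf of_bool_def m_def cH)
      qed
      have c: "(\<Sum>v\<in>G\<times>H. of_bool (g = fst v \<and> h = snd v) :: real) = 1"
      proof -
        have "(\<Sum>v\<in>G\<times>H. of_bool (g = fst v \<and> h = snd v) :: real) = (\<Sum>v\<in>G\<times>H. if v = u then 1 else 0)"
          by (intro sum.cong) (auto simp: gh)
        then show ?thesis using u finG finH by simp
      qed
      have d: "(\<Sum>v\<in>G\<times>H. of_bool (fst v \<noteq> g) * of_bool (snd v \<noteq> h) :: real) = (m - 1)\<^sup>2"
        unfolding power2_eq_square using sum_product[of "\<lambda>g'. of_bool (g' \<noteq> g) :: real" G "\<lambda>h'. of_bool (h' \<noteq> h)" H]
        by (simp only: a b sum.cartesian_product split_def)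
      show "(case u of (g, h) \<Rightarrow> \<Sum>(g',h')\<in>G\<times>H. of_bool (g = g' \<and> h = h') * ((e + 1) * m) + of_bool (g' \<noteq> g) * of_bool (h' \<noteq> h))
         = (case u of (g, h) \<Rightarrow> (e + 1) * m + (m - 1)\<^sup>2)"
        by (simp only: gh split_def fst_conv snd_conv sum.distrib c d sum_distrib_right[symmetric] mult_1)
    qed
    also have "\<dots> = m\<^sup>2 * ((e + 1) * m) + m\<^sup>2 * (m - 1)\<^sup>2"
      by (simp add: split_def card_cartesian_product cH M_def[symmetric] m_def power2_eq_square algebra_simps)
    finally show ?thesis .
  qed
  \<comment> \<open>x + c g = lam g' would write lam as x / g' + c g / g', a sum of two k-th
    powers.\<close>
  have R0: "R c x = 0" if c: "c \<in> G" and x: "x \<in> G0" for c x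
    unfolding R_def
  proof (intro sum.neutral ballI)
    fix g h assume gh: "g \<in> G" "h \<in> H"
    then obtain g' where g': "g' \<in> G" "h = lam * g'" by (auto simp: H_def)
    have nz: "g' \<noteq> 0" using g' GK by (auto simp: Ks_def)
    have "x \<noteq> h - c * g"
    proof
      assume "x = h - c * g"
      then have "lam = x / g' + (c * g) / g'" using g' nz by (simp add: field_simps)
      moreover have "(c * g) / g' \<in> G0" using Gmult Gdiv c gh g' by (simp add: G0_def)
      ultimately show False using nolam G0div x g' by blast
    qed
    then show "of_bool (x = h - c * g) = (0::real)" by simp
  qed
  define N where "N = Ks - G"
  define N0 where "N0 = K - G0"
  have finN: "finite N" "finite N0" "finite G0" using finKs fin finG by (auto simp: N_def N0_def G0_def)
  have cG0: "real (card G0) = m + 1" 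
  proof -
    have "0 \<notin> G" using GK by (auto simp: Ks_def)
    then show ?thesis using finG by (simp add: G0_def m_def M_def)
  qed
  have cN: "real (card N) = e * m"
  proof -
    have "card N = card Ks - M" unfolding N_def M_def using GK finG by (simp add: card_Diff_subset)
    then show ?thesis using rKs cKs D1 by (simp add: e_def m_def algebra_simps of_nat_diff)
  qed
  have cN0: "real (card N0) = e * m"
  proof -
    have "N0 = N" using GK zero by (auto simp: N0_def N_def G0_def Ks_def)
    then show ?thesis using cN by simp
  qed
  have splitK: "sum f K = sum f G0 + sum f N0" for f :: "'a \<Rightarrow> real"
    unfolding N0_def using sum.subset_diff[OF G0K fin, of f] by simp
  have splitKs: "sum f Ks = sum f G + sum f N" for f :: "'a \<Rightarrow> real"
    unfolding N_def using sum.subset_diff[OF GK finKs, of f] by simp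
  have GG0: "(\<Sum>c\<in>G. \<Sum>x\<in>G0. R c x) = 0" using R0 by (simp add: sum.neutral)
  have NG0: "(\<Sum>c\<in>N. \<Sum>x\<in>G0. R c x) = m\<^sup>2 * (m + 1)"
  proof -
    have "(\<Sum>c\<in>Ks. \<Sum>x\<in>G0. R c x) = (\<Sum>x\<in>G0. \<Sum>c\<in>Ks. R c x)" by (rule sum.swap)
    also have "\<dots> = m\<^sup>2 * (m + 1)" using S3 cG0 by simp
    finally show ?thesis using splitKs[of "\<lambda>c. \<Sum>x\<in>G0. R c x"] GG0 by simp
  qed
  have GN0: "(\<Sum>c\<in>G. \<Sum>x\<in>N0. R c x) = m * m\<^sup>2"
  proof -
    have "(\<Sum>c\<in>G. \<Sum>x\<in>K. R c x) = m * m\<^sup>2" using S1 GK by (simp add: subset_iff m_def M_def)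
    then show ?thesis using GG0 by (simp add: splitK sum.distrib)
  qed
  have NN0: "(\<Sum>c\<in>N. \<Sum>x\<in>N0. R c x) = m\<^sup>2 * ((e - 1) * m - 1)"
  proof -
    have "(\<Sum>c\<in>N. \<Sum>x\<in>K. R c x) = e * m * m\<^sup>2" using S1 cN by (simp add: N_def)
    then show ?thesis using NG0 by (simp add: splitK sum.distrib algebra_simps)
  qed
  \<comment> \<open>\<mu> is the mean of \<open>R\<close> over N x G0 and also over G x N0; \<nu> is
    its mean over N x N0.\<close>
  define \<mu> where "\<mu> = m / e"
  define \<nu> where "\<nu> = ((e - 1) * m - 1) / e\<^sup>2"
  have "(\<Sum>c\<in>Ks. \<Sum>x\<in>K. (R c x)\<^sup>2) =
     (\<Sum>c\<in>G. \<Sum>x\<in>G0. (R c x)\<^sup>2) + (\<Sum>c\<in>N. \<Sum>x\<in>G0. (R c x)\<^sup>2) + (\<Sum>c\<in>G. \<Sum>x\<in>N0. (R c x)\<^sup>2) + (\<Sum>c\<in>N. \<Sum>x\<in>N0. (R c x)\<^sup>2)"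
    by (simp add: splitK splitKs sum.distrib)
  moreover have "(\<Sum>c\<in>G. \<Sum>x\<in>G0. (R c x)\<^sup>2) \<ge> 0" by (intro sum_nonneg) auto
  moreover have "(\<Sum>c\<in>N. \<Sum>x\<in>G0. (R c x)\<^sup>2) \<ge> m\<^sup>2 * (m * (m + 1) / e)"
  proof -
    have "2 * \<mu> * (m\<^sup>2 * (m + 1)) - \<mu>\<^sup>2 * (e * m) * (m + 1) = m\<^sup>2 * (m * (m + 1) / e)"
      using e1 by (simp add: \<mu>_def field_simps power2_eq_square)
    then show ?thesis using sum_sq_lower_bound[OF finN(1,3), of \<mu> R] by (simp only: NG0 cN cG0)
  qed
  moreover have "(\<Sum>c\<in>G. \<Sum>x\<in>N0. (R c x)\<^sup>2) \<ge> m\<^sup>2 * (m\<^sup>2 / e)"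
  proof -
    have "2 * \<mu> * (m * m\<^sup>2) - \<mu>\<^sup>2 * m * (e * m) = m\<^sup>2 * (m\<^sup>2 / e)"
      using e1 by (simp add: \<mu>_def field_simps power2_eq_square)
    then show ?thesis using sum_sq_lower_bound[OF finG finN(2), of \<mu> R] by (simp only: GN0 cN0 M_def[symmetric] m_def[symmetric])
  qed
  moreover have "(\<Sum>c\<in>N. \<Sum>x\<in>N0. (R c x)\<^sup>2) \<ge> m\<^sup>2 * (((e - 1) * m - 1)\<^sup>2 / e\<^sup>2)"
  proof -
    define w where "w = (e - 1) * m - 1"
    have "2 * (w / e\<^sup>2) * (m\<^sup>2 * w) - (w / e\<^sup>2)\<^sup>2 * (e * m) * (e * m) = m\<^sup>2 * (w\<^sup>2 / e\<^sup>2)"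
      using e1 by (simp add: field_simps power2_eq_square)
    then show ?thesis using sum_sq_lower_bound[OF finN(1,2), of \<nu> R] by (simp only: NN0 cN0 cN \<nu>_def w_def)
  qed
  ultimately have "m\<^sup>2 * (m * (m + 1) / e + m\<^sup>2 / e + ((e - 1) * m - 1)\<^sup>2 / e\<^sup>2) \<le> m\<^sup>2 * ((e + 1) * m + (m - 1)\<^sup>2)"
    using S2 by (simp only: distrib_left)
  then have "m * (m + 1) / e + m\<^sup>2 / e + ((e - 1) * m - 1)\<^sup>2 / e\<^sup>2 \<le> (e + 1) * m + (m - 1)\<^sup>2"
    using mpos by (simp add: mult_le_cancel_left_pos)
  then show False by (rule variance_inequality_contradiction[OF e1 mbig])
qed

section \<open>Roots of triangular matrices\<close>

lemma upper_triangular_mult_entry: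
  fixes A B :: "'a :: semiring_0 mat"
  assumes A: "A \<in> carrier_mat n n" "upper_triangular A" and B: "B \<in> carrier_mat n n" "upper_triangular B"
    and ij: "j \<le> i" "i < n"
  shows "(A * B) $$ (i, j) = (if i = j then A $$ (i, i) * B $$ (i, i) else 0)"
proof -
  have "(A * B) $$ (i, j) = (\<Sum>l<n. A $$ (i, l) * B $$ (l, j))"
    using A B ij by (simp add: scalar_prod_def atLeast0LessThan)
  also have "\<dots> = (\<Sum>l<n. if l = i \<and> i = j then A $$ (i, i) * B $$ (i, i) else 0)"
  proof (intro sum.cong refl)
    fix l assume l: "l \<in> {..<n}"
    show "A $$ (i, l) * B $$ (l, j) = (if l = i \<and> i = j then A $$ (i, i) * B $$ (i, i) else 0)"
    proof (cases "l < i")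
      case True
      then show ?thesis using A ij by (simp add: upper_triangularD)
    next
      case False
      show ?thesis
      proof (cases "l = i \<and> i = j")
        case True
        then show ?thesis by simp
      next
        case F: False
        then have "j < l" using False ij by auto
        then have "B $$ (l, j) = 0" using B l by (auto intro!: upper_triangularD)
        then show ?thesis using F by auto
      qed
    qed
  qed
  also have "\<dots> = (if i = j then A $$ (i, i) * B $$ (i, i) else 0)"
    using ij by (cases "i = j") auto
  finally show ?thesis .
qed

lemma upper_triangular_pow:
  fixes A :: "'a :: semiring_1 mat"
  assumes A: "A \<in> carrier_mat n n" "upper_triangular A"
  shows "upper_triangular (A ^\<^sub>m k) \<and> (\<forall>i<n. (A ^\<^sub>m k) $$ (i, i) = (A $$ (i, i)) ^ k)"
proof (induction k)
  case 0
  then show ?case using A by auto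
next
  case (Suc k)
  have c: "A ^\<^sub>m k \<in> carrier_mat n n" using A by simp
  show ?case
  proof (intro conjI upper_triangularI allI impI)
    fix i j assume "j < i" "i < dim_row (A ^\<^sub>m Suc k)"
    then show "(A ^\<^sub>m Suc k) $$ (i, j) = 0"
      using upper_triangular_mult_entry[OF c _ A, of j i] Suc A by simp
  next
    fix i assume "i < n"
    then show "(A ^\<^sub>m Suc k) $$ (i, i) = A $$ (i, i) ^ Suc k"
      using upper_triangular_mult_entry[OF c _ A, of i i] Suc by (simp add: power_Suc2 del: power_Suc)
  qed
qed

text \<open>This is the sum of c^(k-1-s) A^s over s < k: the quotient of A^k - c^k by A - c, in a
  form that survives A - c being singular.\<close>

primrec geometric_mat :: "'a :: semiring_1 \<Rightarrow> 'a mat \<Rightarrow> nat \<Rightarrow> 'a mat" where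
  "geometric_mat c A 0 = 0\<^sub>m (dim_row A) (dim_row A)"
| "geometric_mat c A (Suc k) = A ^\<^sub>m k + c \<cdot>\<^sub>m geometric_mat c A k"

lemma geometric_mat_carrier [simp]:
  "A \<in> carrier_mat n n \<Longrightarrow> geometric_mat c A k \<in> carrier_mat n n"
  by (induction k) auto

text \<open>The corner of the power is linear in v, so a k-th root with a prescribed corner exists
  once the geometric matrix is invertible.\<close>

lemma pow_four_block_upper:
  fixes A :: "'a :: comm_ring_1 mat"
  assumes A: "A \<in> carrier_mat n n" and v: "v \<in> carrier_mat n 1"
  shows "four_block_mat A v (0\<^sub>m 1 n) (c \<cdot>\<^sub>m 1\<^sub>m 1) ^\<^sub>m k =
    four_block_mat (A ^\<^sub>m k) (geometric_mat c A k * v) (0\<^sub>m 1 n) (c ^ k \<cdot>\<^sub>m 1\<^sub>m 1)"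
proof (induction k)
  case 0
  have "geometric_mat c A 0 * v = 0\<^sub>m n 1" using A v by auto
  then show ?case using A by (intro eq_matI) auto
next
  case (Suc k)
  let ?G = "geometric_mat c A k"
  have G: "?G \<in> carrier_mat n n" "dim_row ?G = n" "dim_col ?G = n" using geometric_mat_carrier[OF A] by auto
  have "?G * v * (c \<cdot>\<^sub>m 1\<^sub>m 1) = c \<cdot>\<^sub>m (?G * v)"
    using G v by (subst mult_smult_distrib[of _ n 1 _ 1]) auto
  also have "\<dots> = (c \<cdot>\<^sub>m ?G) * v"
    using G v by (subst mult_smult_assoc_mat[of _ n n _ 1]) auto
  finally have tr: "A ^\<^sub>m k * v + ?G * v * (c \<cdot>\<^sub>m 1\<^sub>m 1) = geometric_mat c A (Suc k) * v"
    using A G v by (subst geometric_mat.simps, subst add_mult_distrib_mat[of _ n n _ _ 1]) auto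
  have br: "(c ^ k \<cdot>\<^sub>m 1\<^sub>m 1) * (c \<cdot>\<^sub>m 1\<^sub>m 1) = (c ^ Suc k \<cdot>\<^sub>m 1\<^sub>m 1 :: 'a mat)"
    by (intro eq_matI) (auto simp: scalar_prod_def mult.commute)
  show ?case
    unfolding pow_mat.simps Suc.IH
    by (subst mult_four_block_mat[of _ n n _ 1 _ 1 _ _ n _ 1])
       (use A v G tr br in \<open>auto simp del: geometric_mat.simps\<close>)
qed

text \<open>A diagonal entry a of A contributes (a^k - c^k) / (a - c) if a differs from c, and k
  c^(k-1) otherwise. Both are multiplied out to avoid division and the exponent k - 1.\<close>

lemma geometric_mat_upper_triangular:
  fixes A :: "'a :: comm_ring_1 mat"
  assumes A: "A \<in> carrier_mat n n" "upper_triangular A"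
  shows "upper_triangular (geometric_mat c A k) \<and>
    (\<forall>i<n. (A $$ (i, i) - c) * geometric_mat c A k $$ (i, i) = (A $$ (i, i)) ^ k - c ^ k) \<and>
    (\<forall>i<n. A $$ (i, i) = c \<longrightarrow> c * geometric_mat c A k $$ (i, i) = of_nat k * c ^ k)"
proof (induction k)
  case 0
  then show ?case using A by auto
next
  case (Suc k)
  have c: "A ^\<^sub>m k \<in> carrier_mat n n" "geometric_mat c A k \<in> carrier_mat n n" using A by simp_all
  have p: "upper_triangular (A ^\<^sub>m k)" "\<And>i. i < n \<Longrightarrow> (A ^\<^sub>m k) $$ (i, i) = (A $$ (i, i)) ^ k"
    using upper_triangular_pow[OF A] by auto
  have entry: "geometric_mat c A (Suc k) $$ (i, j) = (A ^\<^sub>m k) $$ (i, j) + c * geometric_mat c A k $$ (i, j)"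
    if "i < n" "j < n" for i j using that c by simp
  show ?case
  proof (intro conjI upper_triangularI allI impI)
    fix i j assume "j < i" "i < dim_row (geometric_mat c A (Suc k))"
    then show "geometric_mat c A (Suc k) $$ (i, j) = 0"
      using Suc p(1) c by (subst entry) (auto simp: upper_triangularD)
  next
    fix i assume i: "i < n"
    then have "(A $$ (i, i) - c) * geometric_mat c A k $$ (i, i) = (A $$ (i, i)) ^ k - c ^ k" using Suc by blast
    then have "c * ((A $$ (i, i) - c) * geometric_mat c A k $$ (i, i)) = c * ((A $$ (i, i)) ^ k - c ^ k)" by simp
    then show "(A $$ (i, i) - c) * geometric_mat c A (Suc k) $$ (i, i) = A $$ (i, i) ^ Suc k - c ^ Suc k"
      using i p by (subst entry) (auto simp: algebra_simps)
  next
    fix i assume i: "i < n" "A $$ (i, i) = c"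
    then have "c * geometric_mat c A k $$ (i, i) = of_nat k * c ^ k" using Suc by blast
    then show "c * geometric_mat c A (Suc k) $$ (i, i) = of_nat (Suc k) * c ^ Suc k"
      using i p by (subst entry) (auto simp: algebra_simps)
  qed
qed

text \<open>Induction peels off the last row and column; the new corner comes from inverting the
  geometric matrix. The function \<rho> fixes one root per value. Hence distinct diagonal entries of
  the root have distinct k-th powers, while equal ones come from equal entries of T, which are
  nonzero; in both cases the diagonal of the geometric matrix has no zero.\<close>

lemma upper_triangular_root:
  fixes T :: "'a :: field mat"
  assumes k: "of_nat k \<noteq> (0 :: 'a)"
    and T: "T \<in> carrier_mat n n" "upper_triangular T"
    and root: "\<And>i. i < n \<Longrightarrow> \<rho> (T $$ (i, i)) ^ k = T $$ (i, i)"
    and simple_zero: "\<And>i j. i < n \<Longrightarrow> j < n \<Longrightarrow> i \<noteq> j \<Longrightarrow> T $$ (i, i) = T $$ (j, j) \<Longrightarrow> T $$ (i, i) \<noteq> 0"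
  shows "\<exists>A\<in>carrier_mat n n. upper_triangular A \<and> (\<forall>i<n. A $$ (i, i) = \<rho> (T $$ (i, i))) \<and> A ^\<^sub>m k = T"
  using T root simple_zero
proof (induction n arbitrary: T)
  case 0
  then show ?case by (intro bexI[of _ T]) (auto intro!: eq_matI)
next
  case (Suc n)
  obtain T1 T2 T3 T4 where sb: "split_block T n n = (T1, T2, T3, T4)" by (metis prod_cases4)
  have dims: "dim_row T = n + 1" "dim_col T = n + 1" using Suc.prems(1) by auto
  note T = split_block[OF sb dims]
  define t where "t = T $$ (n, n)"
  define c where "c = \<rho> t"
  have ck: "c ^ k = t" using Suc.prems(3)[of n] by (simp add: c_def t_def)
  have T4: "T4 = t \<cdot>\<^sub>m 1\<^sub>m 1" using T(1-4) unfolding t_def T(5) by (intro eq_matI) auto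
  have T1e: "T1 $$ (i, j) = T $$ (i, j)" if "i < n" "j < n" for i j
    using that T(1-4) unfolding T(5) by auto
  have T3: "T3 = 0\<^sub>m 1 n"
  proof (intro eq_matI)
    fix i j assume ij: "i < dim_row (0\<^sub>m 1 n)" "j < dim_col (0\<^sub>m 1 n)"
    then have "T3 $$ (i, j) = T $$ (n, j)" using T(1-4) unfolding T(5) by auto
    also have "\<dots> = 0" using Suc.prems(1,2) ij by (auto intro!: upper_triangularD)
    finally show "T3 $$ (i, j) = 0\<^sub>m 1 n $$ (i, j)" using ij by simp
  qed (use T in auto)
  have "\<exists>A\<in>carrier_mat n n. upper_triangular A \<and> (\<forall>i<n. A $$ (i, i) = \<rho> (T1 $$ (i, i))) \<and> A ^\<^sub>m k = T1"
  proof (rule Suc.IH[OF T(1)])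
    show "upper_triangular T1"
      using Suc.prems(1,2) T(1) T1e by (auto simp: upper_triangular_def)
    show "\<rho> (T1 $$ (i, i)) ^ k = T1 $$ (i, i)" if "i < n" for i
      using Suc.prems(3)[of i] that T1e by simp
    show "T1 $$ (i, i) \<noteq> 0" if "i < n" "j < n" "i \<noteq> j" "T1 $$ (i, i) = T1 $$ (j, j)" for i j
      using Suc.prems(4)[of i j] that T1e by simp
  qed
  then obtain A where A: "A \<in> carrier_mat n n" "upper_triangular A" "\<And>i. i < n \<Longrightarrow> A $$ (i, i) = \<rho> (T $$ (i, i))"
    "A ^\<^sub>m k = T1" using T1e by auto
  let ?G = "geometric_mat c A k"
  have G: "?G \<in> carrier_mat n n" using A by simp
  note Gp = geometric_mat_upper_triangular[OF A(1,2), of c k]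
  have "?G $$ (i, i) \<noteq> 0" if i: "i < n" for i
  proof (cases "A $$ (i, i) = c")
    case True
    have "T $$ (i, i) = t" using Suc.prems(3)[of i] A(3)[OF i] True ck i by simp
    then have "t \<noteq> 0" using Suc.prems(4)[of i n] i by (simp add: t_def)
    then have "of_nat k * c ^ k \<noteq> 0" using k ck by simp
    then show ?thesis using Gp True i by (metis mult_zero_right)
  next
    case False
    then have "T $$ (i, i) \<noteq> t" using A(3)[OF i] by (auto simp: c_def)
    then have "(A $$ (i, i)) ^ k - c ^ k \<noteq> 0" using Suc.prems(3)[of i] A(3)[OF i] i ck by simp
    then show ?thesis using Gp i by (metis mult_zero_right)
  qed
  then have "0 \<notin> set (diag_mat ?G)" using G by (auto simp: diag_mat_def)
  then have "det ?G \<noteq> 0" using upper_triangular_imp_det_eq_0_iff[OF G] Gp by simp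
  from det_non_zero_imp_unit[OF G this, of "()"] obtain H where H: "H \<in> carrier_mat n n" "?G * H = 1\<^sub>m n"
    unfolding Units_def ring_mat_def by auto
  define v where "v = H * T2"
  have v: "v \<in> carrier_mat n 1" using H T by (simp add: v_def)
  have "?G * v = T2" unfolding v_def using H G T(2)
    by (simp flip: assoc_mult_mat[of ?G n n H n T2 1])
  then have pow: "four_block_mat A v (0\<^sub>m 1 n) (c \<cdot>\<^sub>m 1\<^sub>m 1) ^\<^sub>m k = T"
    using pow_four_block_upper[OF A(1) v, of c k] A(4) ck T3 T4 T(5) by simp
  let ?A = "four_block_mat A v (0\<^sub>m 1 n) (c \<cdot>\<^sub>m 1\<^sub>m 1)"
  have "?A \<in> carrier_mat (Suc n) (Suc n)" using A v by auto
  moreover have "upper_triangular ?A" using A v by (auto simp: upper_triangular_def)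
  moreover have "\<forall>i<Suc n. ?A $$ (i, i) = \<rho> (T $$ (i, i))" using A v by (auto simp: less_Suc_eq c_def t_def)
  ultimately show ?case using pow by blast
qed

lemma transpose_pow_mat:
  fixes A :: "'a :: comm_semiring_1 mat"
  assumes A: "A \<in> carrier_mat n n"
  shows "transpose_mat (A ^\<^sub>m k) = transpose_mat A ^\<^sub>m k"
proof (induction k)
  case 0
  then show ?case using A by simp
next
  case (Suc k)
  have tA: "transpose_mat A \<in> carrier_mat n n" using A by simp
  have comm: "B * B ^\<^sub>m j = B ^\<^sub>m j * B" if B: "B \<in> carrier_mat n n" for B :: "'a mat" and j
  proof (induction j)
    case 0
    then show ?case using B by simp
  next
    case (Suc j)
    have "B * (B ^\<^sub>m j * B) = B * B ^\<^sub>m j * B"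
      using B by (intro assoc_mult_mat[symmetric, of _ n n _ n _ n]) auto
    then show ?case using Suc by simp
  qed
  have "transpose_mat (A ^\<^sub>m Suc k) = transpose_mat A * transpose_mat (A ^\<^sub>m k)"
    using A by (simp add: transpose_mult[of _ n n _ n])
  then show ?case using comm[OF tA] Suc by simp
qed

section \<open>Prescribing the diagonal\<close>

definition trace_mat :: "'a :: comm_monoid_add mat \<Rightarrow> 'a" where
  "trace_mat A = (\<Sum>i<dim_row A. A $$ (i, i))"

lemma trace_mult_comm:
  fixes A B :: "'a :: comm_semiring_0 mat"
  assumes A: "A \<in> carrier_mat n m" and B: "B \<in> carrier_mat m n"
  shows "trace_mat (A * B) = trace_mat (B * A)"
proof -
  have "trace_mat (A * B) = (\<Sum>i<n. \<Sum>j<m. A $$ (i, j) * B $$ (j, i))"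
    unfolding trace_mat_def using A B by (auto simp: scalar_prod_def atLeast0LessThan intro!: sum.cong)
  also have "\<dots> = (\<Sum>j<m. \<Sum>i<n. B $$ (j, i) * A $$ (i, j))"
    by (subst sum.swap) (simp add: mult.commute)
  also have "\<dots> = trace_mat (B * A)"
    unfolding trace_mat_def using A B by (auto simp: scalar_prod_def atLeast0LessThan intro!: sum.cong)
  finally show ?thesis .
qed

lemma trace_similar:
  fixes A B :: "'a :: comm_ring_1 mat"
  assumes "similar_mat A B"
  shows "trace_mat A = trace_mat B"
proof -
  obtain n P Q where c: "{A, B, P, Q} \<subseteq> carrier_mat n n" and QP: "Q * P = 1\<^sub>m n" and eq: "A = P * B * Q"
    using similar_matD[OF assms] by blast
  have "trace_mat A = trace_mat (Q * (P * B))"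
    unfolding eq using c by (intro trace_mult_comm[of _ n n]) auto
  also have "Q * (P * B) = Q * P * B" using c by (intro assoc_mult_mat[symmetric, of _ n n _ n _ n]) auto
  also have "\<dots> = B" using c QP by auto
  finally show ?thesis .
qed

lemma similar_mat_carrier:
  assumes "similar_mat A B" "B \<in> carrier_mat n n"
  shows "A \<in> carrier_mat n n"
proof -
  obtain m P Q where c: "{A, B, P, Q} \<subseteq> carrier_mat m m"
    using similar_matD[OF assms(1)] by blast
  then have "m = n" using assms(2) by auto
  then show ?thesis using c by simp
qed

text \<open>A diagonal nonscalar matrix has two different diagonal entries; a transvection mixing
  their indices puts their difference off the diagonal.\<close>

lemma similar_mat_off_diagonal:
  fixes M :: "'a :: field mat"
  assumes M: "M \<in> carrier_mat n n" and ns: "\<And>c. M \<noteq> c \<cdot>\<^sub>m 1\<^sub>m n" and n: "n > 0"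
  shows "\<exists>N. similar_mat N M \<and> (\<exists>a<n. \<exists>b<n. a \<noteq> b \<and> N $$ (a, b) \<noteq> 0)"
proof (cases "\<exists>a<n. \<exists>b<n. a \<noteq> b \<and> M $$ (a, b) \<noteq> 0")
  case True
  then show ?thesis using similar_mat_refl[OF M] by (intro exI[of _ M] conjI)
next
  case False
  have "\<exists>i<n. M $$ (i, i) \<noteq> M $$ (0, 0)"
  proof (rule ccontr)
    assume "\<not> ?thesis"
    then have diag: "M $$ (i, i) = M $$ (0, 0)" if "i < n" for i using that by blast
    have entry: "M $$ (i, j) = (M $$ (0, 0) \<cdot>\<^sub>m 1\<^sub>m n) $$ (i, j)" if "i < n" "j < n" for i j
    proof (cases "i = j")
      case True
      have "M $$ (i, i) = M $$ (0, 0)" by (rule diag[OF that(1)])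
      then show ?thesis using that True by simp
    next
      case ne: False
      have "M $$ (i, j) = 0" using False that ne by blast
      then show ?thesis using that ne by simp
    qed
    have "M = M $$ (0, 0) \<cdot>\<^sub>m 1\<^sub>m n"
      by (rule eq_matI, rule entry) (use M in simp_all)
    then show False using ns by blast
  qed
  then obtain i where i: "i < n" "M $$ (i, i) \<noteq> M $$ (0, 0)" by blast
  then have i0: "i \<noteq> 0" by metis
  have "M $$ (0, i) = 0" "M $$ (i, 0) = 0" using False i i0 n by blast+
  then have "add_col_sub_row 1 0 i M $$ (0, i) \<noteq> 0" using M i i0 n by simp
  moreover have "similar_mat (add_col_sub_row 1 0 i M) M" using i i0 n by (intro add_col_sub_row_similar[OF M]) auto
  ultimately show ?thesis using i i0 n by blast
qed

text \<open>One step of Fillmore's algorithm: transvections with indices at least \<open>s\<close> do not touch the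
  diagonal entries before \<open>s\<close>; they move a nonzero entry into row \<open>s\<close>, then copy it into a row
  below, and finally correct the entry at \<open>s\<close>.\<close>
lemma similar_mat_set_diagonal_entry:
  fixes M :: "'a :: field mat" and u :: 'a
  assumes M: "M \<in> carrier_mat n n" and u: "u \<noteq> 0" "u \<noteq> 1"
    and s: "Suc s < n" and ab: "s \<le> a" "a < n" "s \<le> b" "b < n" "a \<noteq> b" "M $$ (a, b) \<noteq> 0"
  shows "\<exists>N. similar_mat N M \<and> (\<forall>i<s. N $$ (i, i) = M $$ (i, i)) \<and> N $$ (s, s) = x \<and>
    (Suc (Suc s) < n \<longrightarrow> (\<exists>a b. Suc s \<le> a \<and> a < n \<and> Suc s \<le> b \<and> b < n \<and> a \<noteq> b \<and> N $$ (a, b) \<noteq> 0))"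
proof -
  have "\<exists>N b. similar_mat N M \<and> (\<forall>i<s. N $$ (i, i) = M $$ (i, i)) \<and> s < b \<and> b < n \<and> N $$ (s, b) \<noteq> 0"
  proof (cases "a = s \<or> (b \<noteq> s \<and> M $$ (s, b) \<noteq> 0)")
    case True
    then have "s < b" "M $$ (s, b) \<noteq> 0" using ab by auto
    then show ?thesis using similar_mat_refl[OF M] ab by blast
  next
    case False
    then have sa: "s < a" using ab by auto
    show ?thesis
    proof (cases "M $$ (s, a) = 0")
      case False
      then show ?thesis using similar_mat_refl[OF M] ab sa by blast
    next
      case Msa: True
      have *: "similar_mat (add_col_sub_row t s a M) M \<and> (\<forall>i<s. add_col_sub_row t s a M $$ (i, i) = M $$ (i, i))" for t
        using M ab sa s by (auto intro!: add_col_sub_row_similar)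
      show ?thesis
      proof (cases "b = s")
        case True
        define w where "w = M $$ (s, s) - M $$ (a, a)"
        have entry: "add_col_sub_row t s a M $$ (s, a) = t * (w - t * M $$ (a, s))" for t
          using M ab sa s Msa by (simp add: w_def algebra_simps)
        \<comment> \<open>The entry is t times a linear polynomial in t with nonzero slope, so at
          most one of the two nonzero values t = 1 and t = u kills it. This is where a field with
          more than two elements is required.\<close>
        have "w - 1 * M $$ (a, s) \<noteq> 0 \<or> w - u * M $$ (a, s) \<noteq> 0"
          using ab True u by auto
        then obtain t where "t \<noteq> 0" "w - t * M $$ (a, s) \<noteq> 0" using u by (metis zero_neq_one)
        then have "add_col_sub_row t s a M $$ (s, a) \<noteq> 0" using entry by simp
        then show ?thesis using * sa ab by blast
      next
        case bs: False
        have "add_col_sub_row 1 s a M $$ (s, b) \<noteq> 0" using M ab sa s bs False by simp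
        then show ?thesis using * bs ab by (metis le_neq_implies_less)
      qed
    qed
  qed
  then obtain N1 b where N1: "similar_mat N1 M" "\<forall>i<s. N1 $$ (i, i) = M $$ (i, i)" and b: "s < b" "b < n" "N1 $$ (s, b) \<noteq> 0"
    by blast
  have N1c: "N1 \<in> carrier_mat n n" by (rule similar_mat_carrier[OF N1(1) M])
  have "\<exists>N. similar_mat N M \<and> (\<forall>i<s. N $$ (i, i) = M $$ (i, i)) \<and> N $$ (s, b) \<noteq> 0 \<and>
    (Suc (Suc s) < n \<longrightarrow> (\<exists>c. Suc s \<le> c \<and> c < n \<and> c \<noteq> b \<and> N $$ (c, b) \<noteq> 0))"
  proof (cases "Suc (Suc s) < n \<longrightarrow> (\<exists>c. Suc s \<le> c \<and> c < n \<and> c \<noteq> b \<and> N1 $$ (c, b) \<noteq> 0)")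
    case True
    then show ?thesis using N1 b by blast
  next
    case False
    \<comment> \<open>A row below \<open>s\<close> other than \<open>b\<close>: the entry (c, b)
      lies outside row \<open>b\<close> and column \<open>s\<close>, the only ones that the final
      correction alters, so it survives as the off-diagonal entry for the next step.\<close>
    define c where "c = (if b = Suc s then Suc (Suc s) else Suc s)"
    have c: "Suc s \<le> c" "c < n" "c \<noteq> b" using False by (auto simp: c_def)
    let ?N = "add_col_sub_row 1 c s N1"
    have "similar_mat ?N N1" using c s by (intro add_col_sub_row_similar[OF N1c]) auto
    then have "similar_mat ?N M" using N1(1) by (rule similar_mat_trans)
    moreover have "\<forall>i<s. ?N $$ (i, i) = M $$ (i, i)" using N1c c s N1(2) by auto
    moreover have "?N $$ (s, b) \<noteq> 0" "?N $$ (c, b) \<noteq> 0" using N1c c s b False by auto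
    ultimately show ?thesis using c by blast
  qed
  then obtain N2 where N2: "similar_mat N2 M" "\<forall>i<s. N2 $$ (i, i) = M $$ (i, i)" "N2 $$ (s, b) \<noteq> 0"
    and c: "Suc (Suc s) < n \<longrightarrow> (\<exists>c. Suc s \<le> c \<and> c < n \<and> c \<noteq> b \<and> N2 $$ (c, b) \<noteq> 0)"
    by blast
  have N2c: "N2 \<in> carrier_mat n n" by (rule similar_mat_carrier[OF N2(1) M])
  define t where "t = (x - N2 $$ (s, s)) / N2 $$ (s, b)"
  let ?N = "add_col_sub_row t b s N2"
  have "similar_mat ?N N2" using b s by (intro add_col_sub_row_similar[OF N2c]) auto
  then have "similar_mat ?N M" using N2(1) by (rule similar_mat_trans)
  moreover have "\<forall>i<s. ?N $$ (i, i) = M $$ (i, i)" using N2c b s N2(2) by auto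
  moreover have "?N $$ (s, s) = x" using N2c b s N2(3) by (auto simp: t_def)
  moreover have "\<exists>a b. Suc s \<le> a \<and> a < n \<and> Suc s \<le> b \<and> b < n \<and> a \<noteq> b \<and> ?N $$ (a, b) \<noteq> 0" if s2: "Suc (Suc s) < n"
  proof -
    obtain r where r: "Suc s \<le> r" "r < n" "r \<noteq> b" "N2 $$ (r, b) \<noteq> 0" using mp[OF c s2] by blast
    then have "?N $$ (r, b) \<noteq> 0" using N2c b s by simp
    then show ?thesis using b r by (intro exI[of _ r] exI[of _ b]) simp
  qed
  ultimately show ?thesis by (intro exI[of _ ?N] conjI impI)
qed

text \<open>All diagonal entries but the last are set one at a time; the trace then forces the last
  one. The induction carries a nonzero off-diagonal entry in the trailing block as long as that
  block has at least two rows.\<close>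

lemma similar_mat_prescribed_diagonal:
  fixes M :: "'a :: field mat" and u :: 'a
  assumes M: "M \<in> carrier_mat n n" and u: "u \<noteq> 0" "u \<noteq> 1"
    and ns: "\<And>c. M \<noteq> c \<cdot>\<^sub>m 1\<^sub>m n" and n: "n \<ge> 2" and tr: "trace_mat M = (\<Sum>i<n. f i)"
  shows "\<exists>N. similar_mat N M \<and> (\<forall>i<n. N $$ (i, i) = f i)"
proof -
  have "\<exists>N. similar_mat N M \<and> (\<forall>i<s. N $$ (i, i) = f i) \<and>
     (Suc s < n \<longrightarrow> (\<exists>a b. s \<le> a \<and> a < n \<and> s \<le> b \<and> b < n \<and> a \<noteq> b \<and> N $$ (a, b) \<noteq> 0))" if "s < n" for s
    using that
  proof (induction s)
    case 0
    then show ?case using similar_mat_off_diagonal[OF M ns] by auto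
  next
    case (Suc s)
    then obtain N a b where N: "similar_mat N M" "\<forall>i<s. N $$ (i, i) = f i"
      and ab: "s \<le> a" "a < n" "s \<le> b" "b < n" "a \<noteq> b" "N $$ (a, b) \<noteq> 0" by auto
    have Nc: "N \<in> carrier_mat n n" by (rule similar_mat_carrier[OF N(1) M])
    from similar_mat_set_diagonal_entry[OF Nc u Suc.prems ab, of "f s"] obtain N' where N':
      "similar_mat N' N" "\<forall>i<s. N' $$ (i, i) = N $$ (i, i)" "N' $$ (s, s) = f s"
      "Suc (Suc s) < n \<longrightarrow> (\<exists>a b. Suc s \<le> a \<and> a < n \<and> Suc s \<le> b \<and> b < n \<and> a \<noteq> b \<and> N' $$ (a, b) \<noteq> 0)" by blast
    have "N' $$ (i, i) = f i" if "i < Suc s" for i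
      using that N'(2,3) N(2) by (cases "i = s") simp_all
    then show ?case using similar_mat_trans[OF N'(1) N(1)] N'(4) by blast
  qed
  note partial = this
  obtain m where m: "n = Suc m" using n by (cases n) auto
  obtain N where N: "similar_mat N M" "\<forall>i<m. N $$ (i, i) = f i" using partial[of m] m by blast
  have Nc: "N \<in> carrier_mat n n" by (rule similar_mat_carrier[OF N(1) M])
  have "(\<Sum>i<n. N $$ (i, i)) = (\<Sum>i<n. f i)" using trace_similar[OF N(1)] tr Nc by (simp add: trace_mat_def)
  then have "N $$ (m, m) = f m" using N(2) by (simp add: m)
  then have "\<forall>i<n. N $$ (i, i) = f i" using N(2) by (simp add: m less_Suc_eq)
  then show ?thesis using N(1) by blast
qed

section \<open>Sumsets of a multiplicative subgroup\<close>

text \<open>A multiplicative subgroup that generates the additive group of the field. Closure under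
  addition suffices in \<open>span\<close>, because in a finite group a closed set containing 0 is a
  subgroup.\<close>

locale spanning_subgroup =
  fixes S :: "'a :: {field, finite} set"
  assumes one: "1 \<in> S" and zero: "0 \<notin> S"
    and mult: "x \<in> S \<Longrightarrow> y \<in> S \<Longrightarrow> x * y \<in> S"
    and divide: "x \<in> S \<Longrightarrow> y \<in> S \<Longrightarrow> x / y \<in> S"
    and span: "0 \<in> H \<Longrightarrow> S \<subseteq> H \<Longrightarrow> (\<And>x y. x \<in> H \<Longrightarrow> y \<in> H \<Longrightarrow> x + y \<in> H) \<Longrightarrow> H = UNIV"
begin

text \<open>Stable sets are the unions of multiplicative cosets of \<open>S\<close>, possibly
  together with 0.\<close>

definition stable :: "'a set \<Rightarrow> bool" where
  "stable A \<longleftrightarrow> (\<forall>s\<in>S. \<forall>x\<in>A. s * x \<in> A)"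

definition plusS :: "'a set \<Rightarrow> 'a set" where
  "plusS A = {x + s | x s. x \<in> A \<and> s \<in> S}"

text \<open>Exactly n summands are taken, so these sets need not be nested.\<close>

primrec sumsetS :: "nat \<Rightarrow> 'a set" where
  "sumsetS 0 = {0}"
| "sumsetS (Suc n) = plusS (sumsetS n)"

section \<open>Growth of stable sets when \<open>S\<close> is added\<close>

lemma nonzero: "s \<in> S \<Longrightarrow> s \<noteq> 0"
  using zero by blast

lemma stable_image:
  assumes "stable A" "s \<in> S"
  shows "(*) s ` A = A"
proof (rule card_subset_eq)
  show "(*) s ` A \<subseteq> A" using assms by (auto simp: stable_def)
  show "card ((*) s ` A) = card A"
    using nonzero[OF assms(2)] by (intro card_image) (auto simp: inj_on_def)
qed simp

lemma stable_plusS: "stable A \<Longrightarrow> stable (plusS A)"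
  unfolding stable_def plusS_def using mult by (fastforce simp: distrib_left)

lemma stable_sumsetS: "stable (sumsetS n)"
  by (induction n) (auto simp: stable_plusS, simp add: stable_def)

lemma stable_remove_zero: "stable A \<Longrightarrow> stable (A - {0})"
  unfolding stable_def using nonzero by simp

lemma sumsetS_nonempty: "sumsetS n \<noteq> {}"
  using one by (induction n) (auto simp: plusS_def)

lemma translate_subset_plusS: "s \<in> S \<Longrightarrow> (+) s ` A \<subseteq> plusS A"
  unfolding plusS_def by (auto simp: add.commute)

lemma card_translate: "card ((+) s ` A) = card (A :: 'a set)"
  by (intro card_image) simp

text \<open>If the translates by 1 and by another a in S agree, then h = a - 1 is a period of A.
  Stability makes every s h with s in S a period as well; periods form an additive group, so by
  \<open>span\<close> every element is a period.\<close>

lemma stable_eq_UNIV: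
  assumes A: "stable A" "A \<noteq> {}" and card: "card S \<ge> 2" and B: "\<And>s. s \<in> S \<Longrightarrow> (+) s ` A = B"
  shows "A = UNIV"
proof -
  have "\<not> S \<subseteq> {1}"
  proof
    assume "S \<subseteq> {1}"
    then have "card S \<le> card {1::'a}" by (intro card_mono) auto
    then show False using card by simp
  qed
  then obtain a where a: "a \<in> S" "a \<noteq> 1" by blast
  define h where "h = a - 1"
  define H where "H = {y. (+) (y * h) ` A = A}"
  have img: "(+) (x + y) ` A = (+) x ` (+) y ` A" for x y :: 'a by (auto simp: image_image add.assoc)
  have "(+) a ` A = (+) 1 ` A" using B[OF a(1)] B[OF one] by simp
  then have "(+) (-1) ` (+) a ` A = (+) (-1) ` (+) 1 ` A" by simp
  then have "(+) (-1 + a) ` A = (+) (-1 + 1) ` A" by (simp only: img)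
  then have h: "(+) h ` A = A" by (simp add: h_def)
  have "H = UNIV"
  proof (rule span)
    show "0 \<in> H" by (simp add: H_def)
    show "S \<subseteq> H"
    proof
      fix s assume s: "s \<in> S"
      have "(+) (s * h) ` A = (+) (s * h) ` (*) s ` A" using stable_image[OF A(1) s] by simp
      also have "\<dots> = (*) s ` (+) h ` A" by (auto simp: image_image distrib_left)
      also have "\<dots> = A" using h stable_image[OF A(1) s] by simp
      finally show "s \<in> H" by (simp add: H_def)
    qed
    show "x + y \<in> H" if "x \<in> H" "y \<in> H" for x y
      using that by (simp add: H_def distrib_right img)
  qed
  moreover have "h \<noteq> 0" using a by (simp add: h_def)
  ultimately have H: "(+) y ` A = A" for y
  proof -
    have "y / h \<in> H" using \<open>H = UNIV\<close> by simp
    then show ?thesis using \<open>h \<noteq> 0\<close> by (simp add: H_def)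
  qed
  obtain x where x: "x \<in> A" using A by blast
  have "y \<in> A" for y
  proof -
    have "(y - x) + x \<in> (+) (y - x) ` A" using x by (rule imageI)
    then show ?thesis using H by simp
  qed
  then show ?thesis by blast
qed

text \<open>All translates s + A lie in A + S and have the size of A; without growth they would
  coincide.\<close>

lemma card_plusS:
  assumes A: "stable A" "A \<noteq> {}" and card: "card S \<ge> 2" and ne: "A \<noteq> UNIV"
  shows "card A < card (plusS A)"
proof (rule ccontr)
  assume "\<not> ?thesis"
  then have le: "card (plusS A) \<le> card A" by simp
  have "(+) s ` A = plusS A" if "s \<in> S" for s
    using translate_subset_plusS[OF that] le card_translate[of s A]
    by (intro card_seteq) auto
  then show False using stable_eq_UNIV[OF A card] ne by blast
qed

text \<open>Multiplication by s permutes A and multiplies the power sum by s^i.\<close>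

lemma sum_stable:
  fixes i :: nat
  assumes "stable A" "s \<in> S" "s ^ i \<noteq> 1"
  shows "(\<Sum>x\<in>A. x ^ i) = 0"
proof -
  have "inj_on ((*) s) A" using nonzero[OF assms(2)] by (auto simp: inj_on_def)
  then have "(\<Sum>x\<in>(*) s ` A. x ^ i) = (\<Sum>x\<in>A. (s * x) ^ i)" by (simp add: sum.reindex)
  then have "(\<Sum>x\<in>A. x ^ i) = (\<Sum>x\<in>A. s ^ i * x ^ i)"
    by (simp only: stable_image[OF assms(1,2)] power_mult_distrib)
  then have "(\<Sum>x\<in>A. x ^ i) = s ^ i * (\<Sum>x\<in>A. x ^ i)" by (subst sum_distrib_left)
  then show ?thesis using assms(3) by simp
qed

lemma ex_power_neq_one:
  assumes "0 < i" "i < card S"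
  shows "\<exists>s\<in>S. s ^ i \<noteq> 1"
proof (rule ccontr)
  assume "\<not> ?thesis"
  then have "S \<subseteq> {x. x ^ i = 1}" by blast
  then have "card S \<le> card {x::'a. x ^ i = 1}" by (intro card_mono) auto
  also have "\<dots> \<le> i" using card_roots_unity_le(2)[OF assms(1)] .
  finally show False using assms by simp
qed

text \<open>The first two power sums of the stable sets \<open>A\<close> and \<open>A + S\<close> vanish, which leaves
  only \<open>0\<close> and \<open>1\<close> for the unique element of \<open>(A + S) - (A + 1)\<close>.\<close>
lemma card_plusS_nonzero:
  assumes A: "stable A" "A \<noteq> {}" "0 \<notin> A" and card: "card S \<ge> 3" and ne: "A \<noteq> UNIV - {0}"
  shows "card (plusS A) \<ge> card A + 2"
proof (rule ccontr)
  assume "\<not> ?thesis"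
  moreover have "card A < card (plusS A)" using A card by (intro card_plusS) auto
  ultimately have cB: "card (plusS A) = card A + 1" by simp
  define B where "B = plusS A"
  have stB: "stable B" unfolding B_def using A by (simp add: stable_plusS)
  have sub: "(+) 1 ` A \<subseteq> B" unfolding B_def by (rule translate_subset_plusS[OF one])
  have "card (B - (+) 1 ` A) = 1"
    using sub cB card_translate[of 1 A] by (subst card_Diff_subset) (auto simp: B_def)
  then obtain b where b: "B - (+) 1 ` A = {b}" by (auto simp: card_1_singleton_iff)
  then have B: "B = insert b ((+) 1 ` A)" and bn: "b \<notin> (+) 1 ` A" using sub by auto
  obtain s1 where s1: "s1 \<in> S" "s1 ^ 1 \<noteq> 1" using ex_power_neq_one[of 1] card by auto
  obtain s2 where s2: "s2 \<in> S" "s2 ^ 2 \<noteq> 1" using ex_power_neq_one[of 2] card by auto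
  have A1: "(\<Sum>x\<in>A. x) = 0" using sum_stable[OF A(1) s1] by simp
  have A2: "(\<Sum>x\<in>A. x ^ 2) = 0" using sum_stable[OF A(1) s2] by simp
  have "0 = (\<Sum>x\<in>B. x)" using sum_stable[OF stB s1] by simp
  also have "\<dots> = b + (\<Sum>x\<in>A. 1 + x)" unfolding B using bn by (simp add: sum.reindex)
  finally have m1: "b + of_nat (card A) = 0" using A1 by (simp add: sum.distrib)
  have "0 = (\<Sum>x\<in>B. x ^ 2)" using sum_stable[OF stB s2] by simp
  also have "\<dots> = b ^ 2 + (\<Sum>x\<in>A. (1 + x) ^ 2)" unfolding B using bn by (simp add: sum.reindex)
  also have "(\<Sum>x\<in>A. (1 + x) ^ 2) = (\<Sum>x\<in>A. 1 + 2 * x + x ^ 2)"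
    by (intro sum.cong) (auto simp: power2_eq_square algebra_simps)
  also have "\<dots> = of_nat (card A)" using A1 A2 by (simp add: sum.distrib flip: sum_distrib_left)
  finally have "b ^ 2 + of_nat (card A) = 0" by simp
  then have "b * b = b" using m1 by (simp add: power2_eq_square add_eq_0_iff2)
  then have "b = 0 \<or> b = 1" by simp
  have img: "(+) s ` A' = (*) s ` (+) 1 ` A'" if "s \<in> S" "stable A'" for s A'
  proof -
    have "(+) s ` A' = (+) s ` (*) s ` A'" using stable_image[OF that(2,1)] by simp
    also have "\<dots> = (*) s ` (+) 1 ` A'" by (auto simp: image_image distrib_left)
    finally show ?thesis .
  qed
  \<comment> \<open>If b = 0, then 1 + A is B without 0; if b = 1, then 1 + (A with 0) is B. Either
    way a translate by 1 is stable, so by \<open>img\<close> all translates by elements of S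
    coincide and \<open>stable_eq_UNIV\<close> applies.\<close>
  show False
  proof (cases "b = 0")
    case True
    then have eq: "(+) 1 ` A = B - {0}" using B bn by auto
    have "A = UNIV"
    proof (rule stable_eq_UNIV)
      show "(+) s ` A = B - {0}" if "s \<in> S" for s
        using img[OF that A(1)] stable_image[OF stable_remove_zero[OF stB] that] eq by simp
    qed (use A card in auto)
    then show False using A by simp
  next
    case False
    then have b1: "b = 1" using \<open>b = 0 \<or> b = 1\<close> by simp
    have st: "stable (insert 0 A)" using A(1) by (auto simp: stable_def)
    have eq: "(+) 1 ` insert 0 A = B" using B b1 by simp
    have "insert 0 A = UNIV"
    proof (rule stable_eq_UNIV[OF st])
      show "(+) s ` insert 0 A = B" if "s \<in> S" for s
        by (simp only: img[OF that st] stable_image[OF stB that] eq)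
    qed (use card in auto)
    then have "A = UNIV - {0}" using A(3) by auto
    then show False using ne by simp
  qed
qed

text \<open>Without 0, the cosets making up A are disjoint and all have the size of S.\<close>

lemma card_stable_dvd:
  assumes A: "stable A" "0 \<notin> A"
  shows "card S dvd card A"
proof -
  define C where "C = (\<lambda>x. (\<lambda>s. s * x) ` S) ` A"
  have U: "\<Union>C = A"
  proof
    show "\<Union>C \<subseteq> A" using A(1) by (auto simp: C_def stable_def)
    show "A \<subseteq> \<Union>C"
    proof
      fix x assume x: "x \<in> A"
      have "1 * x \<in> (\<lambda>s. s * x) ` S" using one by (rule imageI)
      then show "x \<in> \<Union>C" using x by (auto simp: C_def)
    qed
  qed
  have "card S * card C = card (\<Union>C)"
  proof (rule card_partition)
    show "card c = card S" if "c \<in> C" for c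
    proof -
      obtain x where x: "x \<in> A" "c = (\<lambda>s. s * x) ` S" using \<open>c \<in> C\<close> by (auto simp: C_def)
      then have "x \<noteq> 0" using A by blast
      then show ?thesis unfolding x(2) by (intro card_image) (auto simp: inj_on_def)
    qed
    show "c1 \<inter> c2 = {}" if c: "c1 \<in> C" "c2 \<in> C" "c1 \<noteq> c2" for c1 c2
    proof (rule ccontr)
      obtain x y where x: "c1 = (\<lambda>s. s * x) ` S" and y: "c2 = (\<lambda>s. s * y) ` S"
        using c by (auto simp: C_def)
      assume "c1 \<inter> c2 \<noteq> {}"
      then obtain s t where st: "s \<in> S" "t \<in> S" "s * x = t * y" by (auto simp: x y)
      have "r * x = (r * t / s) * y" for r using st nonzero[OF st(1)] by (simp add: field_simps)
      moreover have "r * y = (r * s / t) * x" for r using st nonzero[OF st(2)] by (simp add: field_simps)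
      ultimately have "c1 \<subseteq> c2" "c2 \<subseteq> c1" unfolding x y using st mult divide by blast+
      then show False using c by blast
    qed
  qed auto
  then show ?thesis unfolding U by (metis dvd_triv_left)
qed

text \<open>S has two elements, so for every x some s in S differs from x, and x - s is
  nonzero.\<close>

lemma sumsetS_full:
  assumes card: "card S \<ge> 2" and full: "UNIV - {0} \<subseteq> sumsetS n"
  shows "sumsetS (Suc n) = UNIV"
proof -
  have "x \<in> sumsetS (Suc n)" for x
  proof -
    have "\<not> S \<subseteq> {x}"
    proof
      assume "S \<subseteq> {x}"
      then have "card S \<le> card {x}" by (intro card_mono) auto
      then show False using card by simp
    qed
    then obtain s where s: "s \<in> S" "s \<noteq> x" by blast
    have "x - s \<in> UNIV - {0}" using s by simp
    then have "x - s \<in> sumsetS n" by (rule subsetD[OF full])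
    then have "\<exists>y t. x = y + t \<and> y \<in> sumsetS n \<and> t \<in> S"
      using s by (intro exI[of _ "x - s"] exI[of _ s]) simp
    then show ?thesis by (simp add: plusS_def)
  qed
  then show ?thesis by blast
qed

lemma sumsetS_mono_full:
  assumes "n \<le> n'" "sumsetS n = UNIV" "card S \<ge> 2"
  shows "sumsetS n' = UNIV"
  using assms(1)
proof (induction rule: dec_induct)
  case base
  show ?case by (rule assms(2))
next
  case (step i)
  then show ?case using sumsetS_full[OF assms(3), of i] by simp
qed

text \<open>Of the two new elements given by \<open>card_plusS_nonzero\<close> at most one is 0. So
  the nonzero part grows, and divisibility by \<open>card S\<close> rounds the growth up to a full
  coset.\<close>

lemma card_sumsetS_nonzero:
  assumes card: "card S \<ge> 3"
  shows "sumsetS (Suc n) - {0} = UNIV - {0} \<or> card (sumsetS (Suc n) - {0}) \<ge> Suc n * card S"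
proof (induction n)
  case 0
  have "sumsetS (Suc 0) = S" by (auto simp: plusS_def)
  then show ?case using zero by simp
next
  case (Suc n)
  let ?A = "sumsetS (Suc n) - {0}" and ?B = "sumsetS (Suc (Suc n)) - {0}"
  show ?case
  proof (cases "?A = UNIV - {0}")
    case True
    then have "sumsetS (Suc (Suc n)) = UNIV" using card by (intro sumsetS_full) auto
    then show ?thesis by simp
  next
    case False
    then have cA: "Suc n * card S \<le> card ?A" using Suc by simp
    have neA: "?A \<noteq> {}"
    proof
      assume "?A = {}"
      then have "card ?A = 0" by (simp only: card.empty)
      then have "Suc n * card S = 0" using cA by (simp only: le_zero_eq)
      then show False using card by simp
    qed
    have stA: "stable ?A" by (intro stable_remove_zero stable_sumsetS)
    have stB: "stable ?B" by (intro stable_remove_zero stable_sumsetS)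
    have "card ?A + 2 \<le> card (plusS ?A)" using stA neA False card by (intro card_plusS_nonzero) auto
    also have "plusS ?A \<subseteq> insert 0 ?B" by (auto simp: plusS_def)
    then have "card (plusS ?A) \<le> card (insert 0 ?B)" by (intro card_mono) auto
    also have "\<dots> = card ?B + 1" by (subst card_insert_disjoint) auto
    finally have less: "card ?A < card ?B" by simp
    obtain a where a: "card ?A = card S * a" using card_stable_dvd[OF stA] by (auto simp: dvd_def)
    obtain b where b: "card ?B = card S * b" using card_stable_dvd[OF stB] by (auto simp: dvd_def)
    have "a < b" using less a b by (metis mult_less_cancel1)
    moreover have "Suc n \<le> a" using cA a card by (metis mult.commute mult_le_cancel1 less_le_trans zero_less_numeral)
    ultimately have "Suc (Suc n) \<le> b" by simp
    then show ?thesis unfolding b by (metis mult.commute mult_le_mono2)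
  qed
qed

lemma nonzero_in_sumsetS:
  assumes card: "card S \<ge> 3" and n: "n > 0" "n * card S \<ge> CARD('a) - 1" and x: "x \<noteq> 0"
  shows "x \<in> sumsetS n"
proof -
  obtain n' where n': "n = Suc n'" using n by (cases n) auto
  have cU: "card (UNIV - {0 :: 'a}) = CARD('a) - 1" by (simp add: card_Diff_singleton)
  have "sumsetS n - {0} = UNIV - {0}"
    using card_sumsetS_nonzero[OF card, of n']
  proof
    assume "Suc n' * card S \<le> card (sumsetS (Suc n') - {0})"
    then have "card (UNIV - {0::'a}) \<le> card (sumsetS n - {0})" using n n' cU by simp
    then show ?thesis by (intro card_seteq) auto
  qed (simp add: n')
  then show ?thesis using x by blast
qed

text \<open>n summands reach every nonzero element; one more also reaches 0, hence n < n'.\<close>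

lemma sumsetS_eq_UNIV:
  assumes card: "card S \<ge> 3" and n: "n * card S \<ge> CARD('a) - 1" "n < n'"
  shows "sumsetS n' = UNIV"
proof -
  have "CARD('a) \<ge> card S" by (intro card_mono) auto
  then have "n > 0" using n(1) card by (cases n) auto
  then have "UNIV - {0} \<subseteq> sumsetS n" using nonzero_in_sumsetS[OF card _ n(1)] by blast
  then have "sumsetS (Suc n) = UNIV" using card by (intro sumsetS_full) auto
  then show ?thesis using n card by (intro sumsetS_mono_full[of "Suc n" n']) auto
qed

text \<open>The weaker growth by one element per step also covers subgroups with just two
  elements.\<close>

lemma card_sumsetS_ge:
  assumes card: "card S \<ge> 2"
  shows "sumsetS n = UNIV \<or> card (sumsetS n) \<ge> n + 1"
proof (induction n)
  case 0
  then show ?case by simp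
next
  case (Suc n)
  show ?case
  proof (cases "sumsetS n = UNIV")
    case True
    then show ?thesis using sumsetS_full[OF card, of n] by simp
  next
    case False
    then show ?thesis using Suc card_plusS[OF stable_sumsetS sumsetS_nonempty card False] by simp
  qed
qed

lemma sumsetS_eq_UNIV_linear:
  assumes card: "card S \<ge> 2" and n: "n + 1 \<ge> CARD('a)"
  shows "sumsetS n = UNIV"
  using card_sumsetS_ge[OF card, of n]
proof
  assume "n + 1 \<le> card (sumsetS n)"
  then show ?thesis using n by (intro card_seteq) auto
qed

lemma sumsetS_add: "x \<in> sumsetS i \<Longrightarrow> y \<in> sumsetS j \<Longrightarrow> x + y \<in> sumsetS (i + j)"
proof (induction j arbitrary: y)
  case (Suc j)
  then obtain z s where "z \<in> sumsetS j" "s \<in> S" "y = z + s" by (auto simp: plusS_def)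
  moreover from this have "x + z \<in> sumsetS (i + j)" using Suc.IH[of z] Suc.prems by simp
  ultimately have "\<exists>w t. x + y = w + t \<and> w \<in> sumsetS (i + j) \<and> t \<in> S"
    by (intro exI[of _ "x + z"] exI[of _ s]) (simp add: add.assoc)
  then show ?case by (simp add: plusS_def)
qed auto

section \<open>Power sums over \<open>S\<close> and binomial coefficients\<close>

lemma sumsetS_1: "sumsetS 1 = S"
  by (auto simp: plusS_def)

text \<open>Multiplication by x in S permutes S; comparing products gives x^|S| = 1, and this
  equation has at most |S| roots. Cosets of S are thus recognised by the value of x^|S|.\<close>

lemma in_S_iff: "x \<in> S \<longleftrightarrow> x ^ card S = 1"
proof -
  define R where "R = {x::'a. x ^ card S = 1}"
  have pos: "card S > 0" using one by (auto simp: card_gt_0_iff)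
  have "S = R"
  proof (rule card_seteq)
    show "S \<subseteq> R"
    proof
      fix x assume x: "x \<in> S"
      have "stable S" using mult by (simp add: stable_def)
      then have "(\<Prod>s\<in>S. s) = (\<Prod>s\<in>(*) x ` S. s)" using stable_image x by simp
      also have "\<dots> = (\<Prod>s\<in>S. x * s)" using nonzero[OF x] by (subst prod.reindex) (auto simp: inj_on_def)
      also have "\<dots> = x ^ card S * (\<Prod>s\<in>S. s)" by (simp add: prod.distrib)
      finally show "x \<in> R" using nonzero by (simp add: R_def)
    qed
    show "card R \<le> card S" unfolding R_def using card_roots_unity_le(2)[OF pos] .
  qed simp
  then have "x \<in> S \<longleftrightarrow> x \<in> R" by (rule arg_cong)
  then show ?thesis by (simp add: R_def)
qed

lemma sum_power_S:
  "(\<Sum>a\<in>S. a ^ i) = (if card S dvd i then of_nat (card S) else 0)"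
proof -
  have Sm: "s ^ card S = 1" if "s \<in> S" for s using that in_S_iff by blast
  have red: "s ^ i = s ^ (i mod card S)" if "s \<in> S" for s
  proof -
    have "s ^ i = s ^ (card S * (i div card S) + i mod card S)" by simp
    also have "\<dots> = s ^ (i mod card S)" unfolding power_add power_mult by (simp add: Sm[OF that])
    finally show ?thesis .
  qed
  have pos: "card S > 0" using one by (auto simp: card_gt_0_iff)
  show ?thesis
  proof (cases "card S dvd i")
    case True
    then have "(\<Sum>a\<in>S. a ^ i) = (\<Sum>a\<in>S. 1)" using red by (intro sum.cong) auto
    then show ?thesis using True by simp
  next
    case False
    then obtain s where "s \<in> S" "s ^ (i mod card S) \<noteq> 1"
      using ex_power_neq_one[of "i mod card S"] pos by (auto simp: mod_greater_zero_iff_not_dvd)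
    moreover have "stable S" using mult by (simp add: stable_def)
    ultimately show ?thesis using sum_stable[of S s i] red False by simp
  qed
qed

text \<open>Summing over S keeps only the exponents divisible by |S|. The shift j takes the values
  0, |S| - 1 and |S| - 2 later, the last two standing for exponents -1 and -2.\<close>

lemma sum_power_binomial:
  "(\<Sum>a\<in>S. a ^ j * (1 + a) ^ N) = of_nat (card S) * (\<Sum>i | i \<le> N \<and> card S dvd i + j. of_nat (N choose i))"
proof -
  have "(\<Sum>a\<in>S. a ^ j * (1 + a) ^ N) = (\<Sum>a\<in>S. \<Sum>i\<le>N. of_nat (N choose i) * a ^ (i + j))"
  proof (intro sum.cong refl)
    fix a :: 'a
    have "(1 + a) ^ N = (\<Sum>i\<le>N. of_nat (N choose i) * a ^ i)"
      using binomial_ring[of a 1 N] by (simp add: add.commute)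
    then show "a ^ j * (1 + a) ^ N = (\<Sum>i\<le>N. of_nat (N choose i) * a ^ (i + j))"
      by (simp add: sum_distrib_left power_add mult_ac)
  qed
  also have "\<dots> = (\<Sum>i\<le>N. of_nat (N choose i) * (\<Sum>a\<in>S. a ^ (i + j)))"
    by (subst sum.swap) (simp add: sum_distrib_left)
  also have "\<dots> = (\<Sum>i\<le>N. if card S dvd i + j then of_nat (card S) * of_nat (N choose i) else 0)"
    by (intro sum.cong) (auto simp: sum_power_S)
  also have "\<dots> = (\<Sum>i | i \<le> N \<and> card S dvd i + j. of_nat (card S) * of_nat (N choose i))"
    by (intro sum.mono_neutral_cong_right) auto
  finally show ?thesis by (simp add: sum_distrib_left)
qed

end

text \<open>Here M is m in the field, G, H, I are the binomials of 2 m over m, m + 1, m + 2, and b,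
  c those of 2 m and m over 2. The first two relations and e4 give H = 1 and M g = M + 1; the others
  then give M (2 M + 1) (M + 1) = 0. The factor 2 M + 1 yields g = -1, while M + 1 = 0 would make M
  g vanish. Stating e6 and e7 for 2 b and 2 c keeps characteristic 2 included.\<close>

lemma binomial_relations_imp_minus_one:
  fixes M G H I g b c :: "'a :: field"
  assumes e1: "2 + G - (1 + g) * 2 + g = 0"
    and e2: "2 * M + H - (1 + g) * M = 0"
    and e3: "b + I - (1 + g) * c = 0"
    and e4: "(M + 1) * H = M * G"
    and e5: "(M + 2) * I = (M - 1) * H"
    and e6: "2 * b = 2 * M * (2 * M - 1)"
    and e7: "2 * c = M * (M - 1)"
    and M: "M \<noteq> 0" and g: "g \<noteq> 0"
  shows "g = -1"
proof -
  have G: "G = g" using e1 by (simp add: algebra_simps)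
  have H: "H = M * (g - 1)" using e2 by (simp add: algebra_simps add_eq_0_iff)
  have "M * ((M + 1) * (g - 1)) = M * g" using e4 G H by (simp add: algebra_simps)
  then have "(M + 1) * (g - 1) = g" using M by simp
  then have Mg: "M * g = M + 1" by (simp add: algebra_simps)
  have H1: "H = 1" using H Mg by (simp add: algebra_simps)
  have "2 * b + 2 * I - (1 + g) * (2 * c) = 2 * (b + I - (1 + g) * c)" by (simp add: algebra_simps)
  then have "2 * M * (2 * M - 1) + 2 * I - (1 + g) * (M * (M - 1)) = 0" using e3 e6 e7 by simp
  moreover have "(1 + g) * (M * (M - 1)) = (M + M * g) * (M - 1)" by (simp add: algebra_simps)
  ultimately have I: "2 * I = (2 * M + 1) * (M - 1) - 2 * M * (2 * M - 1)"
    using Mg by (simp add: algebra_simps)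
  have "(M + 2) * (2 * I) = 2 * ((M + 2) * I)" by (simp only: mult.left_commute)
  also have "\<dots> = 2 * (M - 1)" using e5 H1 by simp
  finally have "(M + 2) * (2 * I) = 2 * (M - 1)" .
  then have "(M + 2) * ((2 * M + 1) * (M - 1) - 2 * M * (2 * M - 1)) = 2 * (M - 1)" using I by simp
  moreover have "(M + 2) * ((2 * M + 1) * (M - 1) - 2 * M * (2 * M - 1)) - 2 * (M - 1) = - (M * ((2 * M + 1) * (M + 1)))"
    by (simp add: algebra_simps)
  ultimately have "M * ((2 * M + 1) * (M + 1)) = 0" by simp
  then consider "2 * M + 1 = 0" | "M + 1 = 0" using M by auto
  then show ?thesis
  proof cases
    case 1
    have "2 * M * g = 2 * M + 2" unfolding mult.assoc Mg by (simp add: distrib_left)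
    moreover have "2 * M = -1" using 1 by (simp add: add_eq_0_iff2)
    ultimately have "- g = -1 + 2" by simp
    then have "- (- g) = - (-1 + 2)" by (rule arg_cong)
    then show ?thesis by simp
  next
    case 2
    then have "M * g = 0" using Mg by simp
    then show ?thesis using M g by simp
  qed
qed

lemma binomial_Suc_step: "Suc j * (N choose Suc j) = (N - j) * (N choose j)"
  using binomial_absorption[of j N] binomial_absorb_comp[of N j] by simp

lemma of_nat_CARD_eq_0: "of_nat (CARD('a)) = (0 :: 'a :: {ring_1, finite})"
proof -
  have "bij ((+) (1::'a))" by (rule bij_plus)
  then have "(\<Sum>x::'a\<in>UNIV. 1 + x) = (\<Sum>x\<in>UNIV. x)" by (rule sum.reindex_bij_betw)
  then show ?thesis by (simp add: sum.distrib)
qed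

context spanning_subgroup
begin

lemma of_nat_card_nonzero:
  assumes "n * card S = CARD('a) - 1"
  shows "of_nat (card S) \<noteq> (0 :: 'a)"
proof
  assume "of_nat (card S) = (0 :: 'a)"
  then have "of_nat (n * card S) = (0 :: 'a)" by simp
  moreover have "CARD('a) = n * card S + 1" using assms by (simp add: Suc_leI)
  moreover have "of_nat (CARD('a)) = (0 :: 'a)" by (rule of_nat_CARD_eq_0)
  ultimately show False by (metis add_0 of_nat_1 of_nat_add zero_neq_one)
qed

text \<open>If \<open>0\<close> is not a sum of \<open>n\<close>, \<open>n - 1\<close> or \<open>n - 2\<close> elements of \<open>S\<close>, counting shows that
  \<open>S + S\<close> is a union \<open>S \<union> c S\<close> of two cosets.  Then \<open>(1 + a)^m\<close> takes only the values \<open>1\<close> and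
  \<open>g = c^m\<close> for \<open>a \<in> S\<close>, \<open>m = card S\<close>, and averaging \<open>a^j ((1 + a)^m - 1) ((1 + a)^m - g)\<close> over \<open>S\<close>
  for \<open>j = 0, -1, -2\<close> forces \<open>g = -1\<close>.\<close>
lemma zero_in_sumsetS:
  assumes card: "card S \<ge> 3" and n: "n \<ge> 4" "even n" and eq: "n * card S = CARD('a) - 1"
  shows "0 \<in> sumsetS n \<or> 0 \<in> sumsetS (n - 1) \<or> 0 \<in> sumsetS (n - 2)"
proof (rule ccontr)
  assume "\<not> ?thesis"
  then have no: "0 \<notin> sumsetS n" "0 \<notin> sumsetS (n - 1)" "0 \<notin> sumsetS (n - 2)" by auto
  define m where "m = card S"
  have m3: "m \<ge> 3" using card by (simp add: m_def)
  have cU: "CARD('a) = n * m + 1" using eq by (simp add: m_def Suc_leI)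
  \<comment> \<open>Parity of n enters here: two summands adding up to 0 could be repeated n / 2
    times.\<close>
  have even0: "0 \<in> sumsetS (2 * j)" if z: "0 \<in> sumsetS 2" for j
  proof (induction j)
    case (Suc j)
    then show ?case using sumsetS_add[OF Suc z] by simp
  qed simp
  have no2: "0 \<notin> sumsetS 2" using even0 no n by (metis evenE)
  have card_ge: "card (sumsetS i) \<ge> i * m" if i: "i > 0" "i < n" and z: "0 \<notin> sumsetS i" for i
  proof -
    obtain i' where i': "i = Suc i'" using i by (cases i) auto
    have d: "sumsetS i - {0} = sumsetS i" using z by simp
    have "card (UNIV - {0 :: 'a}) = n * m" using cU by (simp add: card_Diff_singleton)
    then have "card (UNIV - {0 :: 'a}) \<ge> i * m" using i by simp
    moreover have "sumsetS i - {0} = UNIV - {0} \<or> i * m \<le> card (sumsetS i - {0})"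
      using card_sumsetS_nonzero[OF card, of i'] by (simp only: i' m_def)
    ultimately show ?thesis unfolding d by (elim disjE) (simp_all only:)
  qed
  have c2: "card (sumsetS 2) \<ge> 2 * m" using card_ge[of 2] no2 n by simp
  have cn2: "card (sumsetS (n - 2)) \<ge> (n - 2) * m" using card_ge[of "n - 2"] no n by simp
  \<comment> \<open>-(S + S) and \<open>sumsetS (n - 2)\<close> are disjoint, as a common element
    would give 0 with n summands. They have at least 2 m and (n - 2) m elements, so they fill the n
    m nonzero elements exactly.\<close>
  define N where "N = uminus ` sumsetS 2"
  have cN: "card N = card (sumsetS 2)" unfolding N_def by (intro card_image) auto
  have disj: "N \<inter> sumsetS (n - 2) = {}"
  proof (rule ccontr)
    assume "N \<inter> sumsetS (n - 2) \<noteq> {}"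
    then obtain x where x: "x \<in> sumsetS 2" "- x \<in> sumsetS (n - 2)" by (auto simp: N_def)
    have "2 + (n - 2) = n" using n by simp
    then show False using sumsetS_add[OF x] no by simp
  qed
  have "0 \<notin> N \<union> sumsetS (n - 2)" using no no2 by (auto simp: N_def)
  then have sub: "N \<union> sumsetS (n - 2) \<subseteq> UNIV - {0}" by auto
  have cU0: "card (UNIV - {0 :: 'a}) = n * m" using cU by (simp add: card_Diff_singleton)
  have csum: "card (N \<union> sumsetS (n - 2)) = card N + card (sumsetS (n - 2))"
    using disj by (intro card_Un_disjoint) auto
  have "2 + (n - 2) = n" using n by simp
  then have nm: "n * m = 2 * m + (n - 2) * m" by (metis add_mult_distrib)
  have le: "card (N \<union> sumsetS (n - 2)) \<le> n * m" using card_mono[OF _ sub] cU0 by simp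
  have c2eq: "card (sumsetS 2) = 2 * m" using le csum nm c2 cn2 cN by linarith
  have all: "N \<union> sumsetS (n - 2) = UNIV - {0}"
    using csum cN c2 cn2 nm cU0 by (intro card_seteq sub) auto
  \<comment> \<open>0 is not a sum of n - 1 elements, so -s lies in the other half N. From S inside
    S + S the sumsets increase from index 1 on, and 0 is then not a sum of three elements
    either.\<close>
  have S2: "S \<subseteq> sumsetS 2"
  proof
    fix s assume s: "s \<in> S"
    have "- s \<notin> sumsetS (n - 2)"
    proof
      assume "- s \<in> sumsetS (n - 2)"
      moreover have "s \<in> sumsetS 1" using s sumsetS_1 by simp
      moreover have "n - 2 + 1 = n - 1" using n by simp
      ultimately show False using sumsetS_add[of "- s" "n - 2" s 1] no by simp
    qed
    moreover have "- s \<in> UNIV - {0}" using nonzero[OF s] by simp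
    ultimately have "- s \<in> N" using all by blast
    then show "s \<in> sumsetS 2" by (auto simp: N_def)
  qed
  have grow: "sumsetS (Suc i) \<subseteq> sumsetS (Suc (Suc i))" for i
  proof
    fix x assume "x \<in> sumsetS (Suc i)"
    then obtain y s where "y \<in> sumsetS i" "s \<in> S" "x = y + s" by (auto simp: plusS_def)
    then show "x \<in> sumsetS (Suc (Suc i))" using sumsetS_add[of y i s 2] S2 by auto
  qed
  have "sumsetS 3 \<subseteq> sumsetS i" if "i \<ge> 3" for i
    using that
  proof (induction rule: dec_induct)
    case (step i)
    obtain i' where "i = Suc i'" using step by (cases i) auto
    then show ?case using step.IH grow[of i'] by (simp only:)
  qed simp
  from this[of n] have no3: "0 \<notin> sumsetS 3" using no n by auto
  have "card S < card (sumsetS 2)" using c2eq m3 by (simp add: m_def)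
  then obtain c where c: "c \<in> sumsetS 2" "c \<notin> S" by (metis card_mono finite leD subsetI)
  have c0: "c \<noteq> 0" using c no2 by auto
  have cS: "(\<lambda>s. s * c) ` S \<subseteq> sumsetS 2" using stable_sumsetS[of 2] c by (auto simp: stable_def)
  have "S \<inter> (\<lambda>s. s * c) ` S = {}"
  proof (rule ccontr)
    assume "S \<inter> (\<lambda>s. s * c) ` S \<noteq> {}"
    then obtain s where s: "s \<in> S" "s * c \<in> S" by auto
    then have "(s * c) / s \<in> S" by (intro divide)
    then show False using c nonzero[OF s(1)] by simp
  qed
  moreover have "card ((\<lambda>s. s * c) ` S) = m" unfolding m_def using c0 by (intro card_image) (auto simp: inj_on_def)
  ultimately have "card (S \<union> (\<lambda>s. s * c) ` S) = 2 * m" by (subst card_Un_disjoint) (auto simp: m_def)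
  then have T2: "S \<union> (\<lambda>s. s * c) ` S = sumsetS 2" using S2 cS c2eq by (intro card_seteq) auto
  have Sm: "x \<in> S \<longleftrightarrow> x ^ m = 1" for x unfolding m_def by (rule in_S_iff)
  define g where "g = c ^ m"
  have g0: "g \<noteq> 0" using c0 by (simp add: g_def)
  have quad: "((1 + a) ^ m - 1) * ((1 + a) ^ m - g) = 0" if a: "a \<in> S" for a
  proof -
    have "1 + a \<in> sumsetS (1 + 1)" using a one by (intro sumsetS_add) (simp_all only: sumsetS_1)
    then have "1 + a \<in> S \<union> (\<lambda>s. s * c) ` S" using T2 by (simp only: one_add_one)
    then show ?thesis
    proof
      assume "1 + a \<in> S"
      then show ?thesis using Sm by simp
    next
      assume "1 + a \<in> (\<lambda>s. s * c) ` S"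
      then obtain s where "s \<in> S" "1 + a = s * c" by blast
      then show ?thesis using Sm[of s] by (simp add: power_mult_distrib g_def)
    qed
  qed
  have expand: "a ^ j * (((1 + a) ^ m - 1) * ((1 + a) ^ m - g)) =
      a ^ j * (1 + a) ^ (2 * m) - (1 + g) * (a ^ j * (1 + a) ^ m) + g * a ^ j" for a j
    unfolding mult_2 power_add by (simp add: algebra_simps)
  have main: "(\<Sum>i | i \<le> 2 * m \<and> m dvd i + j. of_nat ((2 * m) choose i))
      - (1 + g) * (\<Sum>i | i \<le> m \<and> m dvd i + j. of_nat (m choose i)) + g * of_bool (m dvd j) = 0" for j
  proof -
    have "0 = (\<Sum>a\<in>S. a ^ j * (((1 + a) ^ m - 1) * ((1 + a) ^ m - g)))"
      using quad by (intro sum.neutral[symmetric]) auto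
    also have "\<dots> = (\<Sum>a\<in>S. a ^ j * (1 + a) ^ (2 * m)) - (1 + g) * (\<Sum>a\<in>S. a ^ j * (1 + a) ^ m) + g * (\<Sum>a\<in>S. a ^ j)"
      by (simp only: expand sum.distrib sum_subtractf sum_distrib_left)
    also have "\<dots> = of_nat m * ((\<Sum>i | i \<le> 2 * m \<and> m dvd i + j. of_nat ((2 * m) choose i))
      - (1 + g) * (\<Sum>i | i \<le> m \<and> m dvd i + j. of_nat (m choose i)) + g * of_bool (m dvd j))"
      unfolding sum_power_binomial sum_power_S m_def[symmetric]
      by (cases "m dvd j") (simp_all add: algebra_simps)
    finally show ?thesis using of_nat_card_nonzero[OF eq] by (simp add: m_def)
  qed
  have sets: "{i. i \<le> 2 * m \<and> m dvd i + 0} = {0, m, 2 * m}" "{i. i \<le> m \<and> m dvd i + 0} = {0, m}"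
    "{i. i \<le> 2 * m \<and> m dvd i + (m - 1)} = {1, m + 1}" "{i. i \<le> m \<and> m dvd i + (m - 1)} = {1}"
    "{i. i \<le> 2 * m \<and> m dvd i + (m - 2)} = {2, m + 2}" "{i. i \<le> m \<and> m dvd i + (m - 2)} = {2}"
  proof -
    have mult_cases: "t = 0 \<or> t = m \<or> t = 2 * m" if "m dvd t" "t < 3 * m" for t
    proof -
      obtain r where r: "t = m * r" using \<open>m dvd t\<close> by (auto simp: dvd_def)
      then have "r < 3" using that m3 by (simp add: mult.commute)
      then have "r = 0 \<or> r = 1 \<or> r = 2" by auto
      then show ?thesis using r by auto
    qed
    have r0: "i = 0 \<or> i = m \<or> i = 2 * m" if "i \<le> 2 * m" "m dvd i + 0" for i using mult_cases[of i] that m3 by auto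
    have r1: "i = 1 \<or> i = m + 1" if "i \<le> 2 * m" "m dvd i + (m - 1)" for i
    proof -
      have "i + (m - 1) < 3 * m" using that(1) m3 by arith
      from mult_cases[OF that(2) this] show ?thesis using m3 by arith
    qed
    have r2: "i = 2 \<or> i = m + 2" if "i \<le> 2 * m" "m dvd i + (m - 2)" for i
    proof -
      have "i + (m - 2) < 3 * m" using that(1) m3 by arith
      from mult_cases[OF that(2) this] show ?thesis using m3 by arith
    qed
    have dv: "m dvd 1 + (m - 1)" "m dvd (m + 1) + (m - 1)" "m dvd 2 + (m - 2)" "m dvd (m + 2) + (m - 2)"
    proof -
      have "1 + (m - 1) = m" "(m + 1) + (m - 1) = m * 2" "2 + (m - 2) = m" "(m + 2) + (m - 2) = m * 2" using m3 by auto
      then show "m dvd 1 + (m - 1)" "m dvd (m + 1) + (m - 1)" "m dvd 2 + (m - 2)" "m dvd (m + 2) + (m - 2)"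
        by (metis dvd_refl dvd_triv_left)+
    qed
    have restrict: "{i. i \<le> m \<and> m dvd i + j} = {i. i \<le> 2 * m \<and> m dvd i + j} \<inter> {..m}" for j by auto
    show s0: "{i. i \<le> 2 * m \<and> m dvd i + 0} = {0, m, 2 * m}"
      by (rule equalityI) (use r0 in blast, auto)
    show s1: "{i. i \<le> 2 * m \<and> m dvd i + (m - 1)} = {1, m + 1}"
    proof (intro equalityI subsetI)
      fix i assume "i \<in> {1, m + 1}"
      then show "i \<in> {i. i \<le> 2 * m \<and> m dvd i + (m - 1)}"
        using dv(1,2) m3 by (elim insertE emptyE) (simp_all only: mem_Collect_eq, auto)
    qed (use r1 in blast)
    show s2: "{i. i \<le> 2 * m \<and> m dvd i + (m - 2)} = {2, m + 2}"
    proof (intro equalityI subsetI)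
      fix i assume "i \<in> {2, m + 2}"
      then show "i \<in> {i. i \<le> 2 * m \<and> m dvd i + (m - 2)}"
        using dv(3,4) m3 by (elim insertE emptyE) (simp_all only: mem_Collect_eq, auto)
    qed (use r2 in blast)
    show "{i. i \<le> m \<and> m dvd i + 0} = {0, m}" unfolding restrict s0 using m3 by auto
    show "{i. i \<le> m \<and> m dvd i + (m - 1)} = {1}" unfolding restrict s1 using m3 by auto
    show "{i. i \<le> m \<and> m dvd i + (m - 2)} = {2}" unfolding restrict s2 using m3 by auto
  qed
  have nd: "\<not> m dvd m - 1" "\<not> m dvd m - 2" using m3 by (auto dest!: dvd_imp_le)
  have "g = -1"
  proof (rule binomial_relations_imp_minus_one)
    let ?F = "\<lambda>i. of_nat ((2 * m) choose i) :: 'a"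
    show "2 + ?F m - (1 + g) * 2 + g = 0"
      using main[of 0] m3 unfolding sets by (simp add: algebra_simps)
    show "2 * of_nat m + ?F (m + 1) - (1 + g) * of_nat m = 0"
      using main[of "m - 1"] m3 nd unfolding sets by (simp add: algebra_simps)
    show "?F 2 + ?F (m + 2) - (1 + g) * of_nat (m choose 2) = 0"
      using main[of "m - 2"] m3 nd unfolding sets by simp
    have "Suc m * ((2 * m) choose Suc m) = m * ((2 * m) choose m)" using binomial_Suc_step[of m "2 * m"] by simp
    then have "(of_nat (Suc m * ((2 * m) choose Suc m)) :: 'a) = of_nat (m * ((2 * m) choose m))" by (rule arg_cong)
    then show "(of_nat m + 1) * ?F (m + 1) = of_nat m * ?F m" by (simp add: algebra_simps)
    have "Suc (Suc m) * ((2 * m) choose Suc (Suc m)) = (m - 1) * ((2 * m) choose Suc m)" using binomial_Suc_step[of "Suc m" "2 * m"] by simp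
    then have "(of_nat (Suc (Suc m) * ((2 * m) choose Suc (Suc m))) :: 'a) = of_nat ((m - 1) * ((2 * m) choose Suc m))" by (rule arg_cong)
    moreover have "(of_nat (m - 1) :: 'a) = of_nat m - 1" using m3 by (simp add: of_nat_diff)
    ultimately show "(of_nat m + 2) * ?F (m + 2) = (of_nat m - 1) * ?F (m + 1)" by (simp add: algebra_simps)
    have "2 * ((2 * m) choose 2) = (2 * m - 1) * (2 * m)" using binomial_Suc_step[of 1 "2 * m"] by (simp add: numeral_2_eq_2)
    then have "(of_nat (2 * ((2 * m) choose 2)) :: 'a) = of_nat ((2 * m - 1) * (2 * m))" by (rule arg_cong)
    then show "2 * ?F 2 = 2 * of_nat m * (2 * of_nat m - 1)" using m3 by (simp add: of_nat_diff mult_ac)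
    have "2 * (m choose 2) = (m - 1) * m" using binomial_Suc_step[of 1 m] by (simp add: numeral_2_eq_2)
    then have "(of_nat (2 * (m choose 2)) :: 'a) = of_nat ((m - 1) * m)" by (rule arg_cong)
    then show "2 * of_nat (m choose 2) = of_nat m * (of_nat m - 1 :: 'a)" using m3 by (simp add: of_nat_diff mult_ac)
    show "of_nat m \<noteq> (0::'a)" using of_nat_card_nonzero[OF eq] by (simp add: m_def)
    show "g \<noteq> 0" by (rule g0)
  qed
  \<comment> \<open>An even m would put -1 into S and 0 = 1 + (-1) into S + S. For odd m, (-c)^m =
    -g = 1 puts -c into S, and c + (-c) = 0 becomes a sum of three elements of S.\<close>
  have "odd m"
  proof
    assume "even m"
    then have "(-1::'a) ^ m = 1" by simp
    then have "(-1::'a) \<in> S" using Sm by blast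
    then have "1 + (-1) \<in> sumsetS (1 + 1)" using one by (intro sumsetS_add) (simp_all only: sumsetS_1)
    then show False using no2 by (simp only: one_add_one) simp
  qed
  then have "(- c) ^ m = - (c ^ m)" by simp
  then have "- c \<in> S" using Sm \<open>g = -1\<close> by (simp add: g_def)
  then have "- c \<in> sumsetS 1" by (simp only: sumsetS_1)
  from sumsetS_add[OF c(1) this] have "0 \<in> sumsetS (2 + 1)" by simp
  then show False using no3 by simp
qed

end

section \<open>Scalar matrices\<close>

lemma power_CARD_eq_self: "x ^ CARD('a) = (x :: 'a :: {field, finite})"
proof (cases "x = 0")
  case True
  then show ?thesis by (simp add: zero_power)
next
  case False
  have img: "(*) x ` (UNIV - {0}) = UNIV - {0}"
  proof (intro equalityI subsetI)
    fix y :: 'a assume "y \<in> UNIV - {0}"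
    then show "y \<in> (*) x ` (UNIV - {0})" using False by (intro image_eqI[of _ _ "y / x"]) auto
  qed (use False in auto)
  have "(\<Prod>y\<in>UNIV - {0}. y) = (\<Prod>y\<in>(*) x ` (UNIV - {0}). y)" by (simp only: img)
  also have "\<dots> = (\<Prod>y\<in>UNIV - {0}. x * y)" using False by (subst prod.reindex) (auto simp: inj_on_def)
  also have "\<dots> = x ^ card (UNIV - {0 :: 'a}) * (\<Prod>y\<in>UNIV - {0}. y)" by (simp add: prod.distrib)
  finally have "x ^ (CARD('a) - 1) = 1" by (simp add: card_Diff_singleton)
  moreover have "CARD('a) = Suc (CARD('a) - 1)" by simp
  ultimately show ?thesis by (metis power_Suc mult_1_right)
qed

text \<open>The derivative of X^Q - X is -1 because Q vanishes in the field, so all Q roots are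
  simple. This realises a field of order Q inside an algebraic closure.\<close>

lemma card_frobenius_fixed_points:
  fixes Q :: nat
  assumes Q: "Q > 1" and char: "of_nat Q = (0 :: 'b :: alg_closed_field)"
  shows "finite {x :: 'b. x ^ Q = x}" "card {x :: 'b. x ^ Q = x} = Q"
proof -
  define P :: "'b poly" where "P = monom 1 Q - monom 1 1"
  have deg: "degree P = Q"
    unfolding P_def diff_conv_add_uminus using Q by (subst degree_add_eq_left) (auto simp: degree_monom_eq)
  then have nz: "P \<noteq> 0" using Q by auto
  have roots: "{x. poly P x = 0} = {x. x ^ Q = x}" by (auto simp: P_def poly_monom)
  show fin: "finite {x :: 'b. x ^ Q = x}" unfolding roots[symmetric] by (rule poly_roots_finite[OF nz])
  obtain A where A: "size A = degree P" "P = smult (lead_coeff P) (\<Prod>x\<in>#A. [:-x, 1:])"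
    using alg_closed_imp_factorization[OF nz] by blast
  have pd: "pderiv P = -1"
    using char Q by (simp add: P_def pderiv_diff pderiv_monom one_pCons)
  have simple: "count A x \<le> 1" for x
  proof (rule ccontr)
    assume "\<not> count A x \<le> 1"
    then have "{#x, x#} \<subseteq># A" by (auto simp: subseteq_mset_def)
    then obtain B where B: "A = {#x, x#} + B" by (metis subset_mset.add_diff_inverse)
    define R where "R = smult (lead_coeff P) (\<Prod>x\<in>#B. [:-x, 1:])"
    have "P = [:-x, 1:] * ([:-x, 1:] * R)"
      by (subst A(2)) (simp add: B R_def mult.assoc)
    then have "pderiv P = [:-x, 1:] * pderiv ([:-x, 1:] * R) + [:-x, 1:] * R * pderiv [:-x, 1:]"
      by (simp only: pderiv_mult)
    then have "poly (pderiv P) x = 0" by simp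
    then show False using pd by simp
  qed
  have "set_mset A = {x. poly P x = 0}"
  proof -
    have "poly P x = lead_coeff P * (\<Prod>y\<in>#A. x - y)" for x
      by (subst A(2)) (simp add: poly_prod_mset image_mset.compositionality o_def)
    then show ?thesis using nz by auto
  qed
  moreover have "size A = card (set_mset A)"
  proof -
    have "size A = (\<Sum>x\<in>set_mset A. count A x)" by (rule size_multiset_overloaded_eq)
    also have "\<dots> = (\<Sum>x\<in>set_mset A. 1)"
      using simple by (intro sum.cong refl) (metis count_greater_zero_iff le_antisym Suc_leI One_nat_def)
    finally show ?thesis by simp
  qed
  ultimately show "card {x :: 'b. x ^ Q = x} = Q" using A(1) deg roots by simp
qed

lemma scalar_mat_sum_of_two_powers:
  fixes lam :: "'a :: {field, finite}"
  assumes n: "n > 0" and k: "k \<ge> 1" and large: "CARD('a) ^ n > (k - 1) ^ 4"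
    and q: "CARD('a) = CHAR('a) ^ l"
  shows "\<exists>A\<in>carrier_mat n n. \<exists>B\<in>carrier_mat n n. lam \<cdot>\<^sub>m 1\<^sub>m n = A ^\<^sub>m k + B ^\<^sub>m k"
proof -
  define Q where "Q = CARD('a) ^ n"
  define K where "K = {x :: 'a alg_closure. x ^ Q = x}"
  have CARD1: "CARD('a) > 1"
  proof -
    have "card {0, 1 :: 'a} \<le> CARD('a)" by (intro card_mono) auto
    then show ?thesis by simp
  qed
  have Q1: "Q > 1" unfolding Q_def using CARD1 n by (intro one_less_power)
  have l: "l > 0" using q CARD1 by (cases l) auto
  have prime: "prime CHAR('a)"
  proof -
    have "CHAR('a) > 0" using finite_imp_CHAR_pos[where 'a = 'a] by simp
    then show ?thesis by (rule prime_CHAR_semidom)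
  qed
  have Qc: "Q = CHAR('a) ^ (l * n)" by (simp add: Q_def q power_mult)
  have Q0: "of_nat Q = (0 :: 'a alg_closure)"
    unfolding Qc of_nat_power using l n of_nat_CHAR[where 'a = "'a alg_closure"] by (simp add: zero_power)
  have fin: "finite K" and card: "card K = Q"
    unfolding K_def using card_frobenius_fixed_points[OF Q1 Q0] by auto
  have add: "(x + y) ^ Q = x ^ Q + y ^ Q" for x y :: "'a alg_closure"
    by (rule freshmans_dream'[where n = "l * n"]) (use prime Qc in auto)
  have addK: "x + y \<in> K" if "x \<in> K" "y \<in> K" for x y using that by (simp add: K_def add)
  have diffK: "x - y \<in> K" if "x \<in> K" "y \<in> K" for x y
  proof -
    have "x ^ Q = (x - y) ^ Q + y ^ Q" using add[of "x - y" y] by simp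
    then show ?thesis using that by (simp add: K_def eq_diff_eq)
  qed
  have multK: "x * y \<in> K" if "x \<in> K" "y \<in> K" for x y using that by (simp add: K_def power_mult_distrib)
  have divK: "x / y \<in> K" if "x \<in> K" "y \<in> K" for x y using that by (simp add: K_def power_divide)
  have zeroK: "0 \<in> K" and oneK: "1 \<in> K" using Q1 by (simp_all add: K_def)
  have acK: "to_ac x \<in> K" for x :: 'a
  proof -
    have "x ^ CARD('a) ^ i = x" for i by (induction i) (simp_all add: power_mult power_CARD_eq_self)
    then show ?thesis by (simp add: K_def Q_def flip: to_ac_power)
  qed
  obtain a b where ab: "a \<in> K" "b \<in> K" "to_ac lam = a ^ k + b ^ k"
    using sum_of_two_powers[OF fin zeroK oneK diffK multK divK k _ acK[of lam]] large card Q_def by metis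
  interpret vector_space "\<lambda>(c :: 'a) x. to_ac c * x"
    by unfold_locales (auto simp: algebra_simps)
  have sub: "subspace K" unfolding subspace_def using zeroK addK multK[OF acK] by simp
  obtain B where B: "B \<subseteq> K" "independent B" "K \<subseteq> span B"
    by (rule basis_exists[of K])
  have finB: "finite B" using B(1) fin by (rule finite_subset)
  have spanB: "span B = K" by (rule equalityI[OF span_minimal[OF B(1) sub] B(3)])
  define rep where "rep = representation B"
  have rep_sum: "(\<Sum>b\<in>B. to_ac (rep v b) * b) = v" if "v \<in> K" for v
    unfolding rep_def using sum_representation_eq[OF B(2) _ finB subset_refl] that spanB by simp
  have rep_scaled_sum: "rep (\<Sum>i\<in>I. to_ac (f i) * v i) = (\<lambda>b. \<Sum>i\<in>I. f i * rep (v i) b)"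
    if "\<And>i. i \<in> I \<Longrightarrow> v i \<in> K" for I :: "'i set" and f v
  proof -
    have "rep (\<Sum>i\<in>I. to_ac (f i) * v i) = (\<lambda>b. \<Sum>i\<in>I. rep (to_ac (f i) * v i) b)"
      unfolding rep_def using that multK acK spanB by (intro representation_sum[OF B(2)]) simp
    also have "\<dots> = (\<lambda>b. \<Sum>i\<in>I. f i * rep (v i) b)"
      unfolding rep_def using that spanB by (intro ext sum.cong refl) (simp add: representation_scale[OF B(2)])
    finally show ?thesis .
  qed
  have rep_basis: "rep b = (\<lambda>v. if v = b then 1 else 0)" if "b \<in> B" for b
    unfolding rep_def by (rule representation_basis[OF B(2) that])
  \<comment> \<open>Coordinates identify K with the functions from B to the base field; comparing
    sizes gives the dimension n.\<close>
  have "bij_betw (\<lambda>v. restrict (rep v) B) K (B \<rightarrow>\<^sub>E UNIV)"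
  proof (rule bij_betw_imageI)
    show "inj_on (\<lambda>v. restrict (rep v) B) K"
    proof
      fix v w assume vw: "v \<in> K" "w \<in> K" "restrict (rep v) B = restrict (rep w) B"
      then have "rep v b = rep w b" if "b \<in> B" for b using that by (metis restrict_apply')
      then show "v = w" using rep_sum[OF vw(1)] rep_sum[OF vw(2)] by (metis (no_types, lifting) sum.cong)
    qed
    show "(\<lambda>v. restrict (rep v) B) ` K = B \<rightarrow>\<^sub>E UNIV"
    proof (intro equalityI subsetI)
      fix f :: "'a alg_closure \<Rightarrow> 'a" assume f: "f \<in> B \<rightarrow>\<^sub>E UNIV"
      define v where "v = (\<Sum>b\<in>B. to_ac (f b) * b)"
      have "v \<in> span B" unfolding v_def by (intro span_sum span_scale span_base)
      then have vK: "v \<in> K" using spanB by simp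
      have "rep v c = f c" if "c \<in> B" for c
      proof -
        have "rep v c = (\<Sum>b\<in>B. f b * rep b c)" unfolding v_def using B(1) by (subst rep_scaled_sum) auto
        also have "\<dots> = (\<Sum>b\<in>B. if b = c then f c else 0)" by (intro sum.cong) (auto simp: rep_basis)
        finally show ?thesis using that finB by simp
      qed
      then have "restrict (rep v) B = f" using f by (auto simp: PiE_def extensional_def restrict_def)
      then show "f \<in> (\<lambda>v. restrict (rep v) B) ` K" using vK by blast
    qed auto
  qed
  then have "card K = card (B \<rightarrow>\<^sub>E (UNIV :: 'a set))" by (rule bij_betw_same_card)
  also have "\<dots> = CARD('a) ^ card B" using finB by (simp add: card_PiE)
  finally have "CARD('a) ^ n = CARD('a) ^ card B" using card Q_def by simp
  then have cB: "card B = n" using CARD1 by simp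
  obtain h where h: "bij_betw h {0..<n} B" using ex_bij_betw_nat_finite[OF finB] cB by auto
  have hB: "h i \<in> B" if "i < n" for i using h that by (auto simp: bij_betw_def)
  have hK: "h i \<in> K" if "i < n" for i using hB[OF that] B(1) by blast
  have hinj: "h i = h j \<longleftrightarrow> i = j" if "i < n" "j < n" for i j
    using h that by (auto simp: bij_betw_def inj_on_def)
  \<comment> \<open>Column j holds the coordinates of x times the j-th basis element, so this is the
    matrix of multiplication by x.\<close>
  define Phi where "Phi x = mat n n (\<lambda>(i, j). rep (x * h j) (h i))" for x
  have Phi_carrier: "Phi x \<in> carrier_mat n n" for x by (simp add: Phi_def)
  have Phi_add: "Phi (x + y) = Phi x + Phi y" if "x \<in> K" "y \<in> K" for x y
  proof (rule eq_matI)
    fix i j assume "i < dim_row (Phi x + Phi y)" "j < dim_col (Phi x + Phi y)"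
    then have ij: "i < n" "j < n" using Phi_carrier[of y] by auto
    then show "Phi (x + y) $$ (i, j) = (Phi x + Phi y) $$ (i, j)"
      using that hK multK spanB
      by (simp add: Phi_def rep_def distrib_right representation_add[OF B(2)])
  qed (auto simp: Phi_def)
  have Phi_scalar: "Phi (to_ac c) = c \<cdot>\<^sub>m 1\<^sub>m n" for c
  proof (rule eq_matI)
    fix i j assume "i < dim_row (c \<cdot>\<^sub>m 1\<^sub>m n)" "j < dim_col (c \<cdot>\<^sub>m 1\<^sub>m n)"
    then have ij: "i < n" "j < n" by auto
    have "rep (to_ac c * h j) = (\<lambda>b. c * rep (h j) b)"
      unfolding rep_def using hK[OF ij(2)] spanB by (intro representation_scale[OF B(2)]) simp
    then show "Phi (to_ac c) $$ (i, j) = (c \<cdot>\<^sub>m 1\<^sub>m n) $$ (i, j)"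
      using ij hinj by (simp add: Phi_def rep_basis[OF hB])
  qed (auto simp: Phi_def)
  have Phi_mult: "Phi (x * y) = Phi x * Phi y" if xy: "x \<in> K" "y \<in> K" for x y
  proof (rule eq_matI)
    fix i j assume "i < dim_row (Phi x * Phi y)" "j < dim_col (Phi x * Phi y)"
    then have ij: "i < n" "j < n" by (auto simp: Phi_def)
    have "y * h j = (\<Sum>b\<in>B. to_ac (rep (y * h j) b) * b)"
      using rep_sum[OF multK[OF xy(2) hK[OF ij(2)]]] by simp
    also have "\<dots> = (\<Sum>r\<in>{0..<n}. to_ac (rep (y * h j) (h r)) * h r)"
      by (rule sum.reindex_bij_betw[OF h, symmetric])
    finally have "x * y * h j = x * (\<Sum>r\<in>{0..<n}. to_ac (rep (y * h j) (h r)) * h r)" by (simp add: mult.assoc)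
    also have "\<dots> = (\<Sum>r\<in>{0..<n}. to_ac (rep (y * h j) (h r)) * (x * h r))"
      by (simp add: sum_distrib_left mult_ac)
    finally have "rep (x * y * h j) = rep (\<Sum>r\<in>{0..<n}. to_ac (rep (y * h j) (h r)) * (x * h r))"
      by (rule arg_cong)
    also have "\<dots> = (\<lambda>b. \<Sum>r\<in>{0..<n}. rep (y * h j) (h r) * rep (x * h r) b)"
      using hK multK[OF xy(1)] by (intro rep_scaled_sum) simp
    finally have "rep (x * y * h j) (h i) = (\<Sum>r\<in>{0..<n}. rep (y * h j) (h r) * rep (x * h r) (h i))"
      by (rule fun_cong)
    also have "\<dots> = (Phi x * Phi y) $$ (i, j)"
      using ij by (simp add: Phi_def scalar_prod_def mult.commute)
    finally show "Phi (x * y) $$ (i, j) = (Phi x * Phi y) $$ (i, j)" using ij by (simp add: Phi_def)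
  qed (auto simp: Phi_def)
  have powK: "x ^ j \<in> K" if "x \<in> K" for x j using that by (induction j) (auto simp: oneK multK)
  have Phi_pow: "Phi (x ^ j) = Phi x ^\<^sub>m j" if x: "x \<in> K" for x j
  proof (induction j)
    case 0
    have "Phi 1 = 1 \<cdot>\<^sub>m 1\<^sub>m n" using Phi_scalar[of 1] by simp
    also have "\<dots> = 1\<^sub>m n" by (intro eq_matI) auto
    finally show ?case by (simp add: Phi_def)
  next
    case (Suc j)
    have "Phi (x ^ Suc j) = Phi (x ^ j) * Phi x" using Phi_mult[OF powK[OF x, of j] x] by (simp add: mult.commute)
    then show ?case using Suc by simp
  qed
  have "lam \<cdot>\<^sub>m 1\<^sub>m n = Phi (a ^ k + b ^ k)" using Phi_scalar[of lam] ab(3) by simp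
  also have "\<dots> = Phi a ^\<^sub>m k + Phi b ^\<^sub>m k" using ab(1,2) powK by (simp add: Phi_add Phi_pow)
  finally show ?thesis using Phi_carrier by blast
qed

section \<open>Sums of two powers of matrices\<close>

lemma nonscalar_sum_of_two_powers:
  fixes M :: "'a :: field mat" and a b :: "nat \<Rightarrow> 'a"
  assumes M: "M \<in> carrier_mat n n" and u: "u \<noteq> (0 :: 'a)" "u \<noteq> 1"
    and ns: "\<And>c. M \<noteq> c \<cdot>\<^sub>m 1\<^sub>m n" and n: "n \<ge> 2" and k: "of_nat k \<noteq> (0 :: 'a)"
    and tr: "trace_mat M = (\<Sum>i<n. a i + b i)"
    and pow: "\<And>i. i < n \<Longrightarrow> \<exists>x. a i = x ^ k" "\<And>i. i < n \<Longrightarrow> \<exists>x. b i = x ^ k"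
    and a0: "\<And>i j. i < n \<Longrightarrow> j < n \<Longrightarrow> i \<noteq> j \<Longrightarrow> a i = a j \<Longrightarrow> a i \<noteq> 0"
    and b0: "\<And>i j. i < n \<Longrightarrow> j < n \<Longrightarrow> i \<noteq> j \<Longrightarrow> b i = b j \<Longrightarrow> b i \<noteq> 0"
  shows "\<exists>A\<in>carrier_mat n n. \<exists>B\<in>carrier_mat n n. M = A ^\<^sub>m k + B ^\<^sub>m k"
proof -
  obtain N where N: "similar_mat N M" "\<And>i. i < n \<Longrightarrow> N $$ (i, i) = a i + b i"
    using similar_mat_prescribed_diagonal[OF M u ns n tr] by blast
  have Nc: "N \<in> carrier_mat n n" by (rule similar_mat_carrier[OF N(1) M])
  define \<rho> where "\<rho> t = (SOME x. x ^ k = t)" for t :: 'a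
  have \<rho>: "\<rho> t ^ k = t" if "\<exists>x. t = x ^ k" for t
    unfolding \<rho>_def using that by (auto intro: someI)
  \<comment> \<open>The lower triangular part is stored transposed, so that the root lemma for upper
    triangular matrices serves both parts; the root is transposed back as \<open>A'\<close>.\<close>
  define L where "L = mat n n (\<lambda>(i, j). if i = j then a i else if i < j then N $$ (j, i) else 0)"
  define U where "U = mat n n (\<lambda>(i, j). if i = j then b i else if i < j then N $$ (i, j) else 0)"
  have "\<exists>A\<in>carrier_mat n n. upper_triangular A \<and> (\<forall>i<n. A $$ (i, i) = \<rho> (L $$ (i, i))) \<and> A ^\<^sub>m k = L"
    by (rule upper_triangular_root[OF k]) (use pow(1) a0 \<rho> in \<open>auto simp: L_def\<close>)
  then obtain A where A: "A \<in> carrier_mat n n" "A ^\<^sub>m k = L" by blast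
  have "\<exists>A\<in>carrier_mat n n. upper_triangular A \<and> (\<forall>i<n. A $$ (i, i) = \<rho> (U $$ (i, i))) \<and> A ^\<^sub>m k = U"
    by (rule upper_triangular_root[OF k]) (use pow(2) b0 \<rho> in \<open>auto simp: U_def\<close>)
  then obtain B where B: "B \<in> carrier_mat n n" "B ^\<^sub>m k = U" by blast
  define A' where "A' = transpose_mat A"
  have A': "A' \<in> carrier_mat n n" "A' ^\<^sub>m k = transpose_mat L"
    using A transpose_pow_mat[OF A(1), of k] by (simp_all add: A'_def)
  have NLU: "N = A' ^\<^sub>m k + B ^\<^sub>m k"
  proof (rule eq_matI)
    fix i j assume "i < dim_row (A' ^\<^sub>m k + B ^\<^sub>m k)" "j < dim_col (A' ^\<^sub>m k + B ^\<^sub>m k)"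
    then have "i < n" "j < n" by (simp_all add: B(2) U_def)
    then show "N $$ (i, j) = (A' ^\<^sub>m k + B ^\<^sub>m k) $$ (i, j)"
      unfolding A'(2) B(2) using N(2) by (auto simp: L_def U_def)
  qed (use Nc in \<open>simp_all add: B(2) U_def\<close>)
  obtain P Q where PQ: "similar_mat_wit M N P Q" using similar_mat_sym[OF N(1)] by (auto simp: similar_mat_def)
  note w = similar_mat_witD2[OF M PQ]
  have conj: "(P * Y * Q) ^\<^sub>m k = P * Y ^\<^sub>m k * Q" if "Y \<in> carrier_mat n n" for Y
  proof (rule similar_mat_wit_pow_id)
    show "similar_mat_wit (P * Y * Q) Y P Q"
      by (rule similar_mat_witI[of _ _ n]) (use w that in auto)
  qed
  have "M = P * (A' ^\<^sub>m k + B ^\<^sub>m k) * Q" using w(3) NLU by simp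
  also have "\<dots> = (P * A' ^\<^sub>m k + P * B ^\<^sub>m k) * Q"
    using w(6) A'(1) B(1) by (subst mult_add_distrib_mat[of _ n n _ n]) auto
  also have "\<dots> = P * A' ^\<^sub>m k * Q + P * B ^\<^sub>m k * Q"
    using w(6,7) A'(1) B(1) by (subst add_mult_distrib_mat[of _ n n _ _ n]) auto
  also have "\<dots> = (P * A' * Q) ^\<^sub>m k + (P * B * Q) ^\<^sub>m k" using conj A'(1) B(1) by simp
  finally have "M = (P * A' * Q) ^\<^sub>m k + (P * B * Q) ^\<^sub>m k" .
  moreover have "P * A' * Q \<in> carrier_mat n n" "P * B * Q \<in> carrier_mat n n" using w(6,7) A'(1) B(1) by auto
  ultimately show ?thesis by blast
qed

section \<open>Distributing the summands of the trace over two diagonals\<close>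

lemma (in spanning_subgroup) sumsetS_imp_sum:
  assumes "x \<in> sumsetS s"
  shows "\<exists>f. (\<forall>i<s. f i \<in> S) \<and> x = (\<Sum>i<s. f i)"
  using assms
proof (induction s arbitrary: x)
  case 0
  then show ?case by simp
next
  case (Suc s)
  then obtain y t where y: "y \<in> sumsetS s" "t \<in> S" "x = y + t" by (auto simp: plusS_def)
  then obtain f where f: "\<forall>i<s. f i \<in> S" "y = (\<Sum>i<s. f i)" using Suc.IH by blast
  show ?case using f y by (intro exI[of _ "f(s := t)"]) (auto simp: less_Suc_eq)
qed

lemma sum_even_odd: "(\<Sum>i<2 * n. f i) = (\<Sum>i<n. f (2 * i) + f (2 * i + 1))"
  for f :: "nat \<Rightarrow> 'a :: comm_monoid_add"
  by (induction n) (auto simp: add.assoc)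

text \<open>Pad the s summands with zeros to length 2 n and separate even from odd positions. Only
  positions 2 n - 2 and 2 n - 1 can hold a zero, and they have different parity, so each part
  receives at most one.\<close>

lemma (in spanning_subgroup) sumsetS_split:
  assumes "x \<in> sumsetS s" "2 * n - 2 \<le> s" "s \<le> 2 * n"
  shows "\<exists>a b. x = (\<Sum>i<n. a i + b i) \<and> (\<forall>i. a i \<in> insert 0 S \<and> b i \<in> insert 0 S) \<and>
    (\<forall>i j. i < n \<longrightarrow> j < n \<longrightarrow> i \<noteq> j \<longrightarrow> a i = a j \<longrightarrow> a i \<noteq> 0) \<and>
    (\<forall>i j. i < n \<longrightarrow> j < n \<longrightarrow> i \<noteq> j \<longrightarrow> b i = b j \<longrightarrow> b i \<noteq> 0)"
proof -
  obtain f where f: "\<forall>i<s. f i \<in> S" "x = (\<Sum>i<s. f i)" using sumsetS_imp_sum[OF assms(1)] by blast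
  define g where "g i = (if i < s then f i else 0)" for i
  have "(\<Sum>i<2 * n. g i) = (\<Sum>i<s. f i)"
    using assms(3) by (intro sum.mono_neutral_cong_right) (auto simp: g_def)
  then have x: "x = (\<Sum>i<n. g (2 * i) + g (2 * i + 1))" using f(2) by (simp only: sum_even_odd)
  have gS: "g i \<in> insert 0 S" for i using f(1) by (simp add: g_def)
  have g0: "g i \<noteq> 0" if "i < 2 * n - 2" for i
  proof -
    have "i < s" using that assms(2) by simp
    then show ?thesis using f(1) nonzero by (simp add: g_def)
  qed
  have a: "g (2 * i) \<noteq> 0" if "i < n" "j < n" "i \<noteq> j" "g (2 * i) = g (2 * j)" for i j
  proof -
    have "2 * i < 2 * n - 2 \<or> 2 * j < 2 * n - 2" using that by auto
    then show ?thesis using g0 that(4) by metis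
  qed
  have b: "g (2 * i + 1) \<noteq> 0" if "i < n" "j < n" "i \<noteq> j" "g (2 * i + 1) = g (2 * j + 1)" for i j
  proof -
    have "2 * i + 1 < 2 * n - 2 \<or> 2 * j + 1 < 2 * n - 2" using that by auto
    then show ?thesis using g0 that(4) by metis
  qed
  show ?thesis
    using x gS a b by (intro exI[of _ "\<lambda>i. g (2 * i)"] exI[of _ "\<lambda>i. g (2 * i + 1)"] conjI allI impI)
qed

section \<open>Powers of scalar matrices, kernel of the power map, pigeonhole\<close>

lemma scalar_mat_pow: "(c \<cdot>\<^sub>m 1\<^sub>m n) ^\<^sub>m k = (c :: 'a :: comm_ring_1) ^ k \<cdot>\<^sub>m 1\<^sub>m n"
proof (induction k)
  case 0
  show ?case by (intro eq_matI) auto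
next
  case (Suc k)
  have "(c ^ k \<cdot>\<^sub>m 1\<^sub>m n) * (c \<cdot>\<^sub>m 1\<^sub>m n) = c ^ Suc k \<cdot>\<^sub>m 1\<^sub>m n"
    by (subst mult_smult_distrib[of _ n n _ n]) (auto intro!: eq_matI simp: mult.commute)
  then show ?case using Suc by simp
qed

lemma power_gcd_eq_one:
  fixes x :: "'a :: field"
  assumes "x ^ a = 1" "x ^ b = 1" "a \<noteq> 0"
  shows "x ^ gcd a b = 1"
proof -
  obtain u v where "a * u = b * v + gcd a b" using bezout_nat[OF assms(3)] by blast
  then have "(x ^ a) ^ u = (x ^ b) ^ v * x ^ gcd a b" by (metis power_add power_mult)
  then show ?thesis using assms by simp
qed

lemma sum_of_two_in_large_set:
  fixes T :: "'a :: {ab_group_add, finite} set"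
  assumes "CARD('a) < 2 * card T"
  shows "\<exists>x\<in>T. \<exists>y\<in>T. c = x + y"
proof (rule ccontr)
  assume no: "\<not> ?thesis"
  have "T \<inter> (\<lambda>x. c - x) ` T = {}"
  proof (rule ccontr)
    assume "T \<inter> (\<lambda>x. c - x) ` T \<noteq> {}"
    then obtain x where "x \<in> T" "c - x \<in> T" by blast
    moreover have "c = x + (c - x)" by simp
    ultimately show False using no by blast
  qed
  then have "card (T \<union> (\<lambda>x. c - x) ` T) = card T + card ((\<lambda>x. c - x) ` T)" by (intro card_Un_disjoint) auto
  also have "card ((\<lambda>x. c - x) ` T) = card T" by (intro card_image) (auto simp: inj_on_def)
  finally have "2 * card T \<le> CARD('a)" using card_mono[of UNIV "T \<union> (\<lambda>x. c - x) ` T"] by simp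
  then show False using assms by simp
qed

theorem theorem1p17:
  fixes p q l n k d ell :: nat
    and M :: "'a :: {field, finite} mat"
  assumes "prime p"
    and "q = p ^ l"
    and "CARD('a) = q"
    and "n \<ge> 2"
    and "k \<ge> 1"
    and "d = gcd k (q - 1)"
    and "ell dvd l"
    and "is_subfield_of_order (power_sums k :: 'a set) (p ^ ell)"
    and "ell = l"
    and "\<not> p dvd k"
    and "(q \<ge> 3 * d + 1 \<and>
           ((d > 2 \<and> ereal (real n) > max (ereal ((real d - 1) / 2)) (4 * eln (real k - 1) / ereal (ln (real q))))
            \<or> d = 2))
       \<or> (q = 2 * d + 1 \<and>
           ((d > 2 \<and> ereal (real n) > max (ereal (2 * real d - 1)) (4 * eln (real k - 1) / ereal (ln (real q))))
            \<or> d = 2))"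
    and "M \<in> carrier_mat n n"
  shows "\<exists>A \<in> carrier_mat n n. \<exists>B \<in> carrier_mat n n. M = A ^\<^sub>m k + B ^\<^sub>m k"
proof -
  define S where "S = (\<lambda>x :: 'a. x ^ k) ` (UNIV - {0})"
  define m where "m = card S"
  define \<delta> where "\<delta> = card {x \<in> UNIV - {0 :: 'a}. x ^ k = 1}"
  have q: "CARD('a) = q" by fact
  have k0: "k > 0" using assms(5) by simp
  have d0: "d > 0" using assms(5,6) by simp
  have d2: "d \<ge> 2" and q3: "q \<ge> 2 * d + 1" using assms(11) by auto
  have zk: "(0 :: 'a) ^ k = 0" using k0 by simp
  have sums: "power_sums k = (UNIV :: 'a set)"
  proof (rule card_seteq)
    have "card (power_sums k :: 'a set) = q" using assms(2,8,9) by (simp add: is_subfield_of_order_def)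
    then show "CARD('a) \<le> card (power_sums k :: 'a set)" using q by simp
  qed auto
  interpret spanning_subgroup S
  proof
    show "1 \<in> S" unfolding S_def by (rule image_eqI[of _ _ 1]) auto
    show "0 \<notin> S" by (auto simp: S_def)
    show "x * y \<in> S" if "x \<in> S" "y \<in> S" for x y
      using that unfolding S_def by (auto simp flip: power_mult_distrib)
    show "x / y \<in> S" if "x \<in> S" "y \<in> S" for x y
      using that unfolding S_def by (auto simp flip: power_divide)
    show "H = UNIV" if H: "0 \<in> H" "S \<subseteq> H" "\<And>x y. x \<in> H \<Longrightarrow> y \<in> H \<Longrightarrow> x + y \<in> H" for H
    proof -
      have xk: "x ^ k \<in> H" for x
      proof (cases "x = 0")
        case True
        then show ?thesis using H(1) k0 by (simp add: zero_power)
      next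
        case False
        then have "x ^ k \<in> S" by (simp add: S_def)
        then show ?thesis using H(2) by blast
      qed
      have "(\<Sum>x\<leftarrow>xs. x ^ k) \<in> H" for xs by (induction xs) (simp_all add: H(1,3) xk)
      then have "power_sums k \<subseteq> H" by (auto simp: power_sums_def)
      then show ?thesis using sums by blast
    qed
  qed
  have order: "\<delta> * m = q - 1"
    using card_eq_card_kernel_mult_card_powers[of "UNIV - {0 :: 'a}" k] q
    by (simp add: \<delta>_def m_def S_def card_Diff_singleton)
  \<comment> \<open>Since x^(q-1) = 1 for nonzero x, Bezout places the kernel of the k-th power map
    among the d-th roots of unity. With \<delta> m = q - 1 this bounds m = |S| from below: by 3 in
    case (i), by 2 in case (ii).\<close>
  have \<delta>d: "\<delta> \<le> d"
  proof -
    have "x ^ d = 1" if "x \<noteq> 0" "x ^ k = 1" for x :: 'a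
    proof -
      have "x ^ (q - 1) * x = x" using power_CARD_eq_self[of x] q d0 q3 by (metis Suc_diff_1 power_Suc2 le_trans not_gr_zero add_is_0 le_zero_eq one_neq_zero)
      then have "x ^ (q - 1) = 1" using that by simp
      then show ?thesis using power_gcd_eq_one[OF that(2)] k0 assms(6) by simp
    qed
    then have "\<delta> \<le> card {x :: 'a. x ^ d = 1}" unfolding \<delta>_def by (intro card_mono) auto
    also have "\<dots> \<le> d" by (rule card_roots_unity_le(2)[OF d0])
    finally show ?thesis .
  qed
  have m3: "m \<ge> 3" if "q \<ge> 3 * d + 1"
  proof (rule ccontr)
    assume "\<not> 3 \<le> m"
    then have "\<delta> * m \<le> d * 2" using \<delta>d by (intro mult_le_mono) auto
    then show False using order that d0 by linarith
  qed
  have m2: "m \<ge> 2"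
  proof (rule ccontr)
    assume "\<not> 2 \<le> m"
    then have "\<delta> * m \<le> d * 1" using \<delta>d by (intro mult_le_mono) auto
    then show False using order q3 d0 by linarith
  qed
  have char: "CHAR('a) = p"
  proof -
    have "CHAR('a) > 0" using finite_imp_CHAR_pos[where 'a = 'a] by simp
    then have pr: "prime CHAR('a)" by (rule prime_CHAR_semidom)
    have "of_nat (CARD('a)) = (0 :: 'a)" by (rule of_nat_CARD_eq_0)
    then have "CHAR('a) dvd p ^ l" using q assms(2) by (simp add: of_nat_eq_0_iff_char_dvd del: of_nat_power)
    then have "CHAR('a) dvd p" using pr by (rule prime_dvd_power[rotated])
    then show ?thesis using pr assms(1) by (simp add: primes_dvd_imp_eq)
  qed
  have k_nz: "of_nat k \<noteq> (0 :: 'a)" using assms(10) char by (simp add: of_nat_eq_0_iff_char_dvd)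
  have "\<exists>u :: 'a. u \<noteq> 0 \<and> u \<noteq> 1"
  proof (rule ccontr)
    assume "\<not> ?thesis"
    then have "UNIV \<subseteq> {0, 1 :: 'a}" by auto
    then have "CARD('a) \<le> card {0, 1 :: 'a}" by (intro card_mono) auto
    then show False using q q3 d2 by simp
  qed
  then obtain u :: 'a where u: "u \<noteq> 0" "u \<noteq> 1" by blast
  have S_pow: "\<exists>y. x = y ^ k" if "x \<in> insert 0 S" for x
    using that zk by (auto simp: S_def intro: exI[of _ 0])
  show ?thesis
  proof (cases "\<exists>c. M = c \<cdot>\<^sub>m 1\<^sub>m n")
    case True
    then obtain c where c: "M = c \<cdot>\<^sub>m 1\<^sub>m n" by blast
    show ?thesis
    proof (cases "d = 2")
      case True
      \<comment> \<open>With 0 added, the k-th powers make up more than half of the field.\<close>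
      have "\<delta> * m \<le> 2 * m" using \<delta>d True by (intro mult_le_mono1) simp
      then have "q < 2 * (m + 1)" unfolding order by arith
      then have "CARD('a) < 2 * card (insert 0 S)" using q zero by (simp add: m_def)
      then obtain x y where "x \<in> insert 0 S" "y \<in> insert 0 S" "c = x + y"
        using sum_of_two_in_large_set by blast
      then obtain a b where "c = a ^ k + b ^ k" using S_pow by metis
      then have "M = (a \<cdot>\<^sub>m 1\<^sub>m n) ^\<^sub>m k + (b \<cdot>\<^sub>m 1\<^sub>m n) ^\<^sub>m k"
        unfolding c scalar_mat_pow by (intro eq_matI) auto
      then show ?thesis by (intro bexI[of _ "a \<cdot>\<^sub>m 1\<^sub>m n"] bexI[of _ "b \<cdot>\<^sub>m 1\<^sub>m n"]) auto
    next
      case False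
      then have d3: "d > 2" using d2 by simp
      \<comment> \<open>d > 2 forces k >= 3, so \<open>eln\<close> takes the finite value ln (k - 1)
        and the hypothesis exponentiates to (k - 1)^4 < q^n.\<close>
      have "d \<le> k" using assms(5,6) by (intro dvd_imp_le) auto
      then have k3: "k \<ge> 3" using d3 by simp
      have lnq: "ln (real q) > 0" using q3 d2 by simp
      have "ereal (real n) > 4 * eln (real k - 1) / ereal (ln (real q))"
        using assms(11) False by auto
      then have "real n > 4 * ln (real k - 1) / ln (real q)"
        using k3 lnq by (simp add: eln_def numeral_eq_ereal)
      then have "4 * ln (real k - 1) < real n * ln (real q)" using lnq by (simp add: field_simps)
      then have "ln ((real k - 1) ^ 4) < ln (real q ^ n)" using k3 q3 d2 by (simp add: ln_realpow)
      then have "(real k - 1) ^ 4 < real q ^ n" using k3 q3 d2 by (subst (asm) ln_less_cancel_iff) auto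
      moreover have "real ((k - 1) ^ 4) = (real k - 1) ^ 4" using k3 by (simp add: of_nat_diff)
      ultimately have "real ((k - 1) ^ 4) < real (q ^ n)" by simp
      then have "(k - 1) ^ 4 < CARD('a) ^ n" unfolding q by (rule of_nat_less_imp_less)
      then show ?thesis unfolding c
        using assms(2,4,5) q char by (intro scalar_mat_sum_of_two_powers[where l = l]) auto
    qed
  next
    case False
    have "\<exists>s. trace_mat M \<in> sumsetS s \<and> 2 * n - 2 \<le> s \<and> s \<le> 2 * n"
    proof (cases "q = 2 * d + 1")
      case True
      \<comment> \<open>Growth by one element per summand reaches all of the field after q - 1 = 2 d
        steps. For d = 2 this means q = 5 and four summands, available from n >= 2.\<close>
      have "2 * n + 1 \<ge> q"
      proof (cases "d = 2")
        case True
        then show ?thesis using \<open>q = 2 * d + 1\<close> assms(4) by simp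
      next
        case dn2: False
        then have "real n > 2 * real d - 1" using assms(11) True d0 by auto
        then show ?thesis using True by linarith
      qed
      then have "sumsetS (2 * n) = UNIV" using m2 q by (intro sumsetS_eq_UNIV_linear) (auto simp: m_def)
      then show ?thesis by (intro exI[of _ "2 * n"]) simp
    next
      case qn: False
      then have q3d: "q \<ge> 3 * d + 1" using assms(11) by blast
      then have S3: "card S \<ge> 3" using m3 by (simp add: m_def)
      have od: "\<delta> * card S = CARD('a) - 1" using order q by (simp add: m_def)
      have dn: "d \<le> 2 * n"
      proof (cases "d = 2")
        case True
        then show ?thesis using assms(4) by simp
      next
        case dn2: False
        then have "real n > (real d - 1) / 2" using assms(11) qn by auto
        then have "real d < real (2 * n + 1)" by simp
        then have "d < 2 * n + 1" by (rule of_nat_less_imp_less)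
        then show ?thesis by simp
      qed
      show ?thesis
      proof (cases "\<delta> < 2 * n")
        case True
        have "sumsetS (2 * n) = UNIV" by (rule sumsetS_eq_UNIV[OF S3 _ True]) (simp add: od)
        then show ?thesis by (intro exI[of _ "2 * n"]) simp
      next
        case False
        \<comment> \<open>The extremal case: the 2 n cosets are exactly the nonzero elements. This
          number is even and at least 4, as the argument for trace 0 requires.\<close>
        then have \<delta>n: "\<delta> = 2 * n" using \<delta>d dn by simp
        show ?thesis
        proof (cases "trace_mat M = 0")
          case True
          have "0 \<in> sumsetS (2 * n) \<or> 0 \<in> sumsetS (2 * n - 1) \<or> 0 \<in> sumsetS (2 * n - 2)"
            by (rule zero_in_sumsetS[OF S3]) (use assms(4) od \<delta>n in auto)
          then obtain s where "0 \<in> sumsetS s" "2 * n - 2 \<le> s" "s \<le> 2 * n"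
            by (metis diff_le_self le_refl diff_le_mono2 one_le_numeral)
          then show ?thesis using True by auto
        next
          case t: False
          have "trace_mat M \<in> sumsetS (2 * n)"
            by (rule nonzero_in_sumsetS[OF S3 _ _ t]) (use assms(4) od \<delta>n in auto)
          then show ?thesis by (intro exI[of _ "2 * n"]) simp
        qed
      qed
    qed
    then obtain s where s: "trace_mat M \<in> sumsetS s" "2 * n - 2 \<le> s" "s \<le> 2 * n" by blast
    obtain a b where ab: "trace_mat M = (\<Sum>i<n. a i + b i)" "\<And>i. a i \<in> insert 0 S" "\<And>i. b i \<in> insert 0 S"
      "\<And>i j. i < n \<Longrightarrow> j < n \<Longrightarrow> i \<noteq> j \<Longrightarrow> a i = a j \<Longrightarrow> a i \<noteq> 0"
      "\<And>i j. i < n \<Longrightarrow> j < n \<Longrightarrow> i \<noteq> j \<Longrightarrow> b i = b j \<Longrightarrow> b i \<noteq> 0"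
      using sumsetS_split[OF s] by blast
    show ?thesis
      using False by (intro nonscalar_sum_of_two_powers[OF assms(12) u _ assms(4) k_nz ab(1) S_pow[OF ab(2)] S_pow[OF ab(3)] ab(4,5)]) auto
  qed
qed

end
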